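(* Let $p<q<r<s$ be odd primes such that $r\equiv\pm1\pmod{pq}$ and $s\equiv \pm 1\pmod{pqr}$. Then $A(pqrs)=1$ if and only if $q\equiv -1\pmod p$.
   Context: $\Phi_n(x)$ denotes the $n$th cyclotomic polynomial. The height $A(n)$ is the maximum absolute value of the coefficients of $\Phi_n(x)$. The signs in the two congruences $r\equiv\pm1$ and $s\equiv\pm1$ are independent. *)

theory Defs
  imports Complex_Main "HOL-Computational_Algebra.Polynomial" "HOL-Computational_Algebra.Primes" "HOL-Number_Theory.Cong"
begin

text \<open>
  The cyclotomic polynomial \<open>\<Phi>\<^sub>n\<close> (for \<open>n > 0\<close>) is the monic polynomial whose roots are the
  primitive \<open>n\<close>-th roots of unity \<open>exp (2 \<pi> i k / n)\<close>, \<open>k\<close> coprime to \<open>n\<close>, each simple.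
  It is taken over the complex numbers. Its coefficients are in fact integers, so the modulus
  of a coefficient is its usual absolute value.
\<close>

definition cyclotomic_poly :: "nat \<Rightarrow> complex poly" where
  "cyclotomic_poly n =
     (\<Prod>k | k \<in> {1..n} \<and> coprime k n. [:- cis (2 * pi * real k / real n), 1:])"

definition height :: "nat \<Rightarrow> real" where
  "height n = (MAX i\<in>{..degree (cyclotomic_poly n)}. cmod (coeff (cyclotomic_poly n) i))"

end

(*
  Write B for the pq-th cyclotomic polynomial with coefficients b_j, f and g for the pqr-th and the
  pqrs-th one, and C = (1 + x + ... + x^(p-1)) (1 - x^q), so that B C = 1 - x^(pq); c is the sequence
  of period pq whose first period lists the coefficients of C.  From f B = B(x^r) and g f = f(x^s),
  where r = +-1 modulo pq and s = +-1 modulo pqr, every coefficient of g is, up to sign, either a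
  coefficient of a truncation of f times B, or one of its variants with a bounded correction, and
  these are up to sign the numbers
      F a a' n = sum over j < a and h < a' of b_j b_h c(n - j - h).
  Hence g is flat if and only if all values of F are bounded by 1 in modulus.

  If p does not divide q + 1, the values of b at small indices give a, a', n with F a a' n = 2.
  If q + 1 = l p, the terms of B alternate in sign along an explicit staircase of exponents, so the
  truncations of B have a closed form modulo x^(pq) - 1; in the coordinates of the Chinese remainder
  theorem F is a signed sum of four indicator functions, whose supports exclude values beyond 1.
*)
theory Submission
  imports Defs "HOL-Computational_Algebra.Fundamental_Theorem_Algebra"
begin

subsection \<open>Cyclotomic polynomials and primitive roots of unity\<close>

text \<open>The reduction rests on a gap: each period of \<open>c\<close> ends with
  \<open>p q - p - q\<close> zeros, one fewer than the degree of \<open>B\<close>. Hence expansions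
  with too long a range of summation stay valid on windows of \<open>degree B\<close> indices, and
  such a window meets each residue class modulo \<open>r\<close> at most once, since
  \<open>r\<close> exceeds the degree of \<open>B\<close>.

  The congruence of \<open>q\<close> enters as \<open>1 = l p - q\<close>, which gives every
  exponent explicit Chinese remainder coordinates. In general the positive terms of \<open>B\<close>
  fill a rectangle in these coordinates and the negative terms fill the opposite rectangle; exactly
  when \<open>q\<close> is -1 modulo \<open>p\<close> the latter is a single row.

  An obstacle remains: the closed form of a truncation times \<open>1 + x + ... + x^(q-1)\<close>
  concerns truncations that end in a positive term. As \<open>B\<close> is palindromic with value 1
  at 1, the complement of a truncation has the other type, and complementing both arguments of
  \<open>F\<close> changes only its sign and its index.\<close>

definition primitive_root :: "nat \<Rightarrow> complex \<Rightarrow> bool" where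
  "primitive_root n w \<longleftrightarrow> (\<forall>k. w ^ k = 1 \<longleftrightarrow> n dvd k)"

lemma cis_root_eq_iff:
  assumes "n > 0"
  shows "cis (2 * pi * real j / real n) = cis (2 * pi * real k / real n) \<longleftrightarrow> j mod n = k mod n"
proof -
  have red: "cis (2 * pi * real i / real n) = cis (2 * pi * real (i mod n) / real n)" for i
  proof -
    have "real i = real n * real (i div n) + real (i mod n)"
      by (metis mult_div_mod_eq of_nat_add of_nat_mult)
    hence "2 * pi * real i / real n = 2 * pi * real (i div n) + 2 * pi * real (i mod n) / real n"
      using assms by (simp add: field_simps)
    moreover have "cis (2 * pi * real (i div n)) = 1"
      by (rule cis_multiple_2pi) simp
    ultimately show ?thesis
      by (simp add: cis_mult [symmetric])
  qed
  have "inj_on (\<lambda>k. cis (2 * pi * real k / real n)) {..<n}"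
    using bij_betw_roots_unity[OF assms] by (simp add: bij_betw_def)
  with assms show ?thesis
    by (subst (1 2) red) (auto dest: inj_onD)
qed

lemma primitive_root_cis_iff:
  assumes "n > 0"
  shows "primitive_root n (cis (2 * pi * real k / real n)) \<longleftrightarrow> coprime k n"
proof -
  have pow: "cis (2 * pi * real k / real n) ^ j = 1 \<longleftrightarrow> n dvd k * j" for j
    using cis_root_eq_iff[OF assms, of "k * j" 0]
    by (simp add: DeMoivre mult_ac dvd_eq_mod_eq_0)
  show ?thesis
  proof
    assume *: "primitive_root n (cis (2 * pi * real k / real n))"
    define d where "d = gcd k n"
    obtain k' n' where kn: "k = d * k'" "n = d * n'"
      unfolding d_def by (metis dvd_def gcd_dvd1 gcd_dvd2)
    have "n dvd k * n'"
      unfolding kn by simp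
    hence "n dvd n'"
      using * pow unfolding primitive_root_def by blast
    hence "d = 1"
      using assms kn by (auto simp: dvd_def)
    thus "coprime k n"
      by (simp add: d_def coprime_iff_gcd_eq_1)
  next
    assume "coprime k n"
    thus "primitive_root n (cis (2 * pi * real k / real n))"
      unfolding primitive_root_def pow
      by (simp add: coprime_commute coprime_dvd_mult_right_iff)
  qed
qed

text \<open>Indexing by the roots instead of their exponents turns substitution of
  \<open>x^s\<close> into a question about preimages under the \<open>s\<close>-th power
  map.\<close>

lemma cyclotomic_poly_altdef:
  assumes "n > 0"
  shows "cyclotomic_poly n = (\<Prod>w | primitive_root n w. [:- w, 1:])"
  unfolding cyclotomic_poly_def
proof (rule prod.reindex_bij_betw)
  let ?f = "\<lambda>k. cis (2 * pi * real k / real n)"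
  show "bij_betw ?f {k \<in> {1..n}. coprime k n} {w. primitive_root n w}"
    unfolding bij_betw_def
  proof (intro conjI set_eqI iffI inj_onI)
    fix i j assume ij: "i \<in> {k \<in> {1..n}. coprime k n}" "j \<in> {k \<in> {1..n}. coprime k n}"
      and "?f i = ?f j"
    hence "i mod n = j mod n"
      using cis_root_eq_iff[OF assms] by simp
    moreover have "k mod n = (if k = n then 0 else k)" if "k \<le> n" for k
      using that assms by auto
    ultimately show "i = j"
      using ij by (auto split: if_splits)
  next
    fix w assume "w \<in> ?f ` {k \<in> {1..n}. coprime k n}"
    thus "w \<in> {w. primitive_root n w}"
      using primitive_root_cis_iff[OF assms] by auto
  next
    fix w assume w: "w \<in> {w. primitive_root n w}"
    hence "w ^ n = 1"
      by (simp add: primitive_root_def)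
    then obtain k where k: "k < n" "w = ?f k"
      using bij_betw_roots_unity[OF assms] unfolding bij_betw_def by blast
    \<comment> \<open>Roots of unity are enumerated from 0 to \<open>n - 1\<close>, the product from
      1 to \<open>n\<close>; the two ends give the same root 1.\<close>
    define k' where "k' = (if k = 0 then n else k)"
    have "w = ?f k'"
      using cis_root_eq_iff[OF assms, of k' k] k by (simp add: k'_def)
    moreover have "k' \<in> {1..n}"
      using k assms by (auto simp: k'_def)
    ultimately show "w \<in> ?f ` {k \<in> {1..n}. coprime k n}"
      using primitive_root_cis_iff[OF assms, of k'] w by auto
  qed
qed

lemma finite_primitive_roots [simp]:
  assumes "n > 0"
  shows "finite {w. primitive_root n w}"
proof (rule finite_subset)
  show "{w. primitive_root n w} \<subseteq> {w. w ^ n = 1}"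
    by (simp add: primitive_root_def subset_iff)
  show "finite {w :: complex. w ^ n = 1}"
    using assms by (rule finite_nth_roots)
qed

lemma cyclotomic_poly_1: "cyclotomic_poly 1 = [:-1, 1:]"
proof -
  have "{w. primitive_root 1 w} = {1}"
    by (auto simp: primitive_root_def) (metis power_one_right)
  thus ?thesis
    by (simp add: cyclotomic_poly_altdef del: One_nat_def)
qed

lemma primitive_root_exists:
  assumes "w ^ n = 1" "n > 0"
  obtains d where "d > 0" "primitive_root d w"
proof -
  define d where "d = (LEAST k. k > 0 \<and> w ^ k = 1)"
  have d: "d > 0 \<and> w ^ d = 1"
    unfolding d_def by (rule LeastI[of _ n]) (use assms in auto)
  have "primitive_root d w"
    unfolding primitive_root_def
  proof (intro allI iffI)
    fix k assume k: "w ^ k = 1"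
    have "w ^ k = (w ^ d) ^ (k div d) * w ^ (k mod d)"
      by (metis mult_div_mod_eq power_add power_mult)
    with k d have "w ^ (k mod d) = 1"
      by simp
    moreover have "k mod d < d"
      using d by simp
    ultimately show "d dvd k"
      using not_less_Least[of "k mod d" "\<lambda>k. k > 0 \<and> w ^ k = 1"]
      unfolding d_def[symmetric] by (auto simp: dvd_eq_mod_eq_0)
  next
    fix k assume "d dvd k"
    thus "w ^ k = 1"
      using d by (auto simp: dvd_def power_mult)
  qed
  with d that show ?thesis
    by blast
qed

lemma primitive_root_unique: "primitive_root m w \<Longrightarrow> primitive_root n w \<Longrightarrow> m = n"
  unfolding primitive_root_def by (meson dvd_antisym dvd_refl)

text \<open>If \<open>w\<close> has order \<open>d\<close>, then \<open>w^s\<close> has order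
  \<open>d / s\<close> or \<open>d\<close> according to whether the prime \<open>s\<close> divides
  \<open>d\<close>. Both preimage orders, \<open>m s\<close> and \<open>m\<close>, are genuine
  because \<open>s\<close> does not divide \<open>m\<close>.\<close>

lemma primitive_root_power_prime_iff:
  assumes "prime s" "\<not> s dvd m" "m > 0"
  shows "primitive_root m (w ^ s) \<longleftrightarrow> primitive_root m w \<or> primitive_root (m * s) w"
proof -
  have cop: "coprime m s"
    using assms prime_imp_coprime coprime_commute by blast
  have s0: "s > 0"
    using assms by (simp add: prime_gt_0_nat)
  have pow: "(w ^ s) ^ k = 1 \<longleftrightarrow> w ^ (s * k) = 1" for k
    by (simp add: power_mult)
  show ?thesis
  proof
    assume *: "primitive_root m (w ^ s)"
    hence "w ^ (s * m) = 1"
      by (simp add: primitive_root_def pow)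
    then obtain d where d: "d > 0" "primitive_root d w"
      using primitive_root_exists[of w "s * m"] s0 assms by auto
    have eq: "d dvd s * k \<longleftrightarrow> m dvd k" for k
      using * d(2) unfolding primitive_root_def pow by simp
    show "primitive_root m w \<or> primitive_root (m * s) w"
    proof (cases "s dvd d")
      case True
      then obtain e where e: "d = s * e" ..
      have "e dvd k \<longleftrightarrow> m dvd k" for k
        using eq[of k] s0 unfolding e by simp
      hence "e = m"
        by (meson dvd_antisym dvd_refl)
      with d e show ?thesis
        by (simp add: mult.commute)
    next
      case False
      hence "coprime d s"
        using assms prime_imp_coprime coprime_commute by blast
      hence "d dvd k \<longleftrightarrow> m dvd k" for k
        using eq[of k] by (simp add: coprime_dvd_mult_right_iff)
      hence "d = m"
        by (meson dvd_antisym dvd_refl)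
      with d show ?thesis
        by simp
    qed
  next
    assume "primitive_root m w \<or> primitive_root (m * s) w"
    moreover have "m dvd s * k \<longleftrightarrow> m dvd k" for k
      using cop by (rule coprime_dvd_mult_right_iff)
    moreover have "m * s dvd s * k \<longleftrightarrow> m dvd k" for k
      using s0 by (subst mult.commute) simp
    ultimately show "primitive_root m (w ^ s)"
      unfolding primitive_root_def pow by blast
  qed
qed

text \<open>For nonzero \<open>z\<close> the polynomial has no root in common with its derivative,
  so it is the product over its distinct roots.\<close>

lemma monom_diff_const_factor:
  fixes z :: complex
  assumes "s > 0" "z \<noteq> 0"
  shows "monom 1 s - [:z:] = (\<Prod>w | w ^ s = z. [:- w, 1:])"
proof -
  let ?P = "monom 1 s - [:z:]"
  have rsf: "rsquarefree ?P"
    unfolding rsquarefree_roots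
    using assms by (auto simp: poly_monom pderiv_diff pderiv_monom pderiv_pCons power_0_left)
  have "coeff ?P s = 1"
    using assms by (simp add: coeff_pCons split: nat.split)
  moreover have "degree ?P \<le> s"
    by (rule degree_diff_le) (auto simp: degree_monom_le)
  ultimately have "lead_coeff ?P = 1"
    by (metis le_antisym le_degree zero_neq_one)
  moreover have "{w. poly ?P w = 0} = {w. w ^ s = z}"
    by (auto simp: poly_monom)
  ultimately show ?thesis
    using complex_poly_decompose_rsquarefree[OF rsf] by simp
qed

text \<open>The fibres of the \<open>s\<close>-th power map over the primitive \<open>m\<close>-th
  roots consist of the roots of order \<open>m\<close> and of order \<open>m s\<close>. Each prime
  of the main theorem is adjoined by one use of this identity.\<close>

lemma cyclotomic_poly_mult_prime:
  assumes "prime s" "\<not> s dvd m" "m > 0"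
  shows "cyclotomic_poly (m * s) * cyclotomic_poly m = pcompose (cyclotomic_poly m) (monom 1 s)"
proof -
  have s: "s > 1"
    using assms prime_gt_1_nat by blast
  let ?R = "\<lambda>n. {w. primitive_root n w}"
  have R0: "z \<noteq> 0" if "z \<in> ?R m" for z
  proof
    assume "z = 0"
    moreover have "z ^ m = 1"
      using that by (simp add: primitive_root_def)
    ultimately show False
      using assms(3) by (simp add: power_0_left)
  qed
  have disj: "?R m \<inter> ?R (m * s) = {}"
    using assms s primitive_root_unique[of m _ "m * s"] by fastforce
  have fin: "finite {w. w ^ s = z}" for z :: complex
    using s by (intro finite_nth_roots) simp
  have "pcompose (cyclotomic_poly m) (monom 1 s) = (\<Prod>z\<in>?R m. pcompose [:- z, 1:] (monom 1 s))"
    using assms by (simp add: cyclotomic_poly_altdef pcompose_prod)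
  also have "\<dots> = (\<Prod>z\<in>?R m. monom 1 s - [:z:])"
    by (intro prod.cong refl) (simp add: pcompose_pCons)
  also have "\<dots> = (\<Prod>z\<in>?R m. \<Prod>w | w ^ s = z. [:- w, 1:])"
  proof (rule prod.cong [OF refl])
    fix z assume "z \<in> ?R m"
    thus "monom 1 s - [:z:] = (\<Prod>w | w ^ s = z. [:- w, 1:])"
      using R0 s by (intro monom_diff_const_factor) auto
  qed
  also have "\<dots> = (\<Prod>w\<in>(\<Union>z\<in>?R m. {w. w ^ s = z}). [:- w, 1:])"
    by (rule prod.UNION_disjoint [symmetric]) (use assms fin in auto)
  also have "(\<Union>z\<in>?R m. {w. w ^ s = z}) = ?R m \<union> ?R (m * s)"
    using primitive_root_power_prime_iff[OF assms] by auto
  also have "(\<Prod>w\<in>?R m \<union> ?R (m * s). [:- w, 1:]) =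
      (\<Prod>w\<in>?R m. [:- w, 1:]) * (\<Prod>w\<in>?R (m * s). [:- w, 1:])"
    by (rule prod.union_disjoint) (use assms s disj in simp_all)
  finally show ?thesis
    using assms s by (simp add: cyclotomic_poly_altdef mult.commute)
qed

lemma lead_coeff_cyclotomic_poly [simp]: "lead_coeff (cyclotomic_poly n) = 1"
  by (simp add: cyclotomic_poly_def lead_coeff_prod)

text \<open>A monic polynomial has height at least 1, so only the upper bound is in
  question.\<close>

lemma height_eq_1_iff: "height n = 1 \<longleftrightarrow> (\<forall>i. cmod (coeff (cyclotomic_poly n) i) \<le> 1)"
proof -
  let ?g = "cyclotomic_poly n"
  have fin: "finite ((\<lambda>i. cmod (coeff ?g i)) ` {..degree ?g})"
    by simp
  have "1 \<in> (\<lambda>i. cmod (coeff ?g i)) ` {..degree ?g}"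
    by (rule image_eqI[of _ _ "degree ?g"]) auto
  hence "height n = 1 \<longleftrightarrow> (\<forall>i\<le>degree ?g. cmod (coeff ?g i) \<le> 1)"
    unfolding height_def by (subst Max_eq_iff[OF fin]) (auto simp del: lead_coeff_cyclotomic_poly)
  also have "\<dots> \<longleftrightarrow> (\<forall>i. cmod (coeff ?g i) \<le> 1)"
    by (metis coeff_eq_0 norm_zero not_le zero_le_one)
  finally show ?thesis .
qed

subsection \<open>Polynomials acting on integer-indexed sequences\<close>

text \<open>Convolution with \<open>A\<close>: the variable acts as the backward shift. Sequences on
  all integers form a module over the polynomials, so polynomial identities can be applied to
  periodic sequences without boundary terms.\<close>

definition act :: "'a::comm_ring_1 poly \<Rightarrow> (int \<Rightarrow> 'a) \<Rightarrow> int \<Rightarrow> 'a" where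
  "act A u n = (\<Sum>i\<le>degree A. coeff A i * u (n - int i))"

lemma act_extend: "degree A \<le> N \<Longrightarrow> act A u n = (\<Sum>i\<le>N. coeff A i * u (n - int i))"
  unfolding act_def by (rule sum.mono_neutral_left) (auto simp: coeff_eq_0)

lemma act_0 [simp]: "act 0 u n = 0"
  by (simp add: act_def)

lemma act_pCons [simp]: "act (pCons a A) u n = a * u n + act A u (n - 1)"
proof -
  have "act (pCons a A) u n = (\<Sum>i\<le>Suc (degree A). coeff (pCons a A) i * u (n - int i))"
    by (rule act_extend) (rule degree_pCons_le)
  also have "\<dots> = a * u n + act A u (n - 1)"
    by (simp add: sum.atMost_Suc_shift act_def algebra_simps del: sum.atMost_Suc)
  finally show ?thesis .
qed

lemma act_1 [simp]: "act 1 u n = u n"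
  by (simp add: act_def)

lemma act_add: "act (A + B) u n = act A u n + act B u n"
  by (subst (1 2 3) act_extend[where N = "max (degree A) (degree B)"])
     (auto simp: degree_add_le sum.distrib algebra_simps)

lemma act_smult: "act (smult a A) u n = a * act A u n"
  by (subst act_extend[of _ "degree A"])
     (auto simp: act_def degree_smult_le sum_distrib_left mult.assoc)

lemma act_uminus: "act (- A) u n = - act A u n"
  using act_smult[of "- 1" A u n] by simp

lemma act_diff: "act (A - B) u n = act A u n - act B u n"
  using act_add[of A "- B" u n] by (simp add: act_uminus)

lemma act_mult: "act (A * B) u n = act A (act B u) n"
  by (induction A arbitrary: n) (auto simp: act_add act_smult)

lemma act_commute: "act A (act B u) n = act B (act A u) n"
  by (metis act_mult mult.commute)

lemma act_monom: "act (monom a k) u n = a * u (n - int k)"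
  by (induction k arbitrary: n) (auto simp: monom_0 monom_Suc algebra_simps)

lemma act_sum: "act (\<Sum>i\<in>I. A i) u n = (\<Sum>i\<in>I. act (A i) u n)"
  by (induction I rule: infinite_finite_induct) (auto simp: act_add)

lemma act_fun_diff: "act A (\<lambda>k. u k - v k) n = act A u n - act A v n"
  by (simp add: act_def algebra_simps sum_subtractf)

lemma act_cong: "(\<And>i. i \<le> degree A \<Longrightarrow> u (n - int i) = v (n' - int i)) \<Longrightarrow> act A u n = act A v n'"
  unfolding act_def by (auto intro: sum.cong)

lemma act_pcompose_monom:
  "act (pcompose A (monom 1 s)) u n = (\<Sum>i\<le>degree A. coeff A i * u (n - int (s * i)))"
proof -
  have "act (pcompose A (monom 1 s)) u n = act A (\<lambda>k. u (n + int s * k)) 0"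
  proof (induction A arbitrary: n)
    case (pCons a A)
    have "act A (\<lambda>k. u (n - int s + int s * k)) 0 = act A (\<lambda>k. u (n + int s * k)) (- 1)"
      by (rule act_cong) (simp add: algebra_simps)
    with pCons show ?case
      by (simp add: pcompose_pCons act_add act_mult act_monom)
  qed simp
  thus ?thesis
    by (simp add: act_def)
qed

lemma act_impulse: "act A (\<lambda>k. of_bool (k = 0)) (int n) = coeff A n"
proof -
  have "act A (\<lambda>k. of_bool (k = 0)) (int n) = (\<Sum>i\<le>degree A. if n = i then coeff A i else 0)"
    unfolding act_def by (rule sum.cong) auto
  also have "\<dots> = coeff A n"
    by (simp add: coeff_eq_0)
  finally show ?thesis .
qed

lemma act_impulse_neg: "n < 0 \<Longrightarrow> act A (\<lambda>k. of_bool (k = 0)) n = 0"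
  by (simp add: act_def)

lemma coeff_pcompose_monom:
  fixes A :: "'a::comm_ring_1 poly"
  assumes "s > 0"
  shows "coeff (pcompose A (monom 1 s)) n = (if s dvd n then coeff A (n div s) else 0)"
proof -
  have "coeff (pcompose A (monom 1 s)) n =
      (\<Sum>i\<le>degree A. coeff A i * of_bool (int n - int (s * i) = 0))"
    by (subst act_impulse [symmetric]) (rule act_pcompose_monom)
  also have "\<dots> = (\<Sum>i\<le>degree A. if s dvd n \<and> i = n div s then coeff A i else 0)"
  proof (rule sum.cong [OF refl])
    fix i
    have "int n - int (s * i) = 0 \<longleftrightarrow> n = s * i"
      by (simp only: right_minus_eq of_nat_eq_iff)
    also have "\<dots> \<longleftrightarrow> s dvd n \<and> i = n div s"
      using assms by auto
    finally show "coeff A i * of_bool (int n - int (s * i) = 0) =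
        (if s dvd n \<and> i = n div s then coeff A i else 0)"
      by simp
  qed
  also have "\<dots> = (if s dvd n then coeff A (n div s) else 0)"
    by (simp add: coeff_eq_0)
  finally show ?thesis .
qed

text \<open>The periodic unit impulse stands for 1 modulo \<open>x^m - 1\<close>;
  \<open>act A (delta m)\<close> lists the coefficients of \<open>A\<close> reduced modulo
  \<open>x^m - 1\<close>.\<close>

definition delta :: "nat \<Rightarrow> int \<Rightarrow> 'a::comm_ring_1" where
  "delta m n = of_bool (int m dvd n)"

lemma act_cong_periodic:
  assumes "\<And>i j. [i = j] (mod m) \<Longrightarrow> u i = u j" "[n = n'] (mod m)"
  shows "act A u n = act A u n'"
  by (rule act_cong, rule assms(1), rule cong_diff) (auto simp: assms(2))

lemma delta_cong: "[i = j] (mod int m) \<Longrightarrow> delta m i = delta m j"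
  by (simp add: delta_def cong_dvd_iff)

lemma act_delta_cong: "[i = j] (mod int m) \<Longrightarrow> act A (delta m) i = act A (delta m) j"
  by (rule act_cong_periodic[OF delta_cong])

lemma act_delta_coeff:
  assumes "degree A < m" "n < m"
  shows "act A (delta m) (int n) = coeff A n"
proof -
  have "act A (delta m) (int n) = act A (\<lambda>k. of_bool (k = 0)) (int n)"
  proof (rule act_cong)
    fix i assume "i \<le> degree A"
    hence "\<bar>int n - int i\<bar> < int m"
      using assms by linarith
    thus "delta m (int n - int i) = (of_bool (int n - int i = 0) :: 'a)"
      unfolding delta_def using dvd_imp_le_int[of "int n - int i" "int m"] by fastforce
  qed
  thus ?thesis
    by (simp add: act_impulse)
qed

text \<open>
  If \<open>A C = 1 - x\<^sup>m\<close> then the \<open>m\<close>-periodic sequence \<open>\<gamma>\<close> with period \<open>C\<close>, cut off at negative indices,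
  is the power series \<open>1 / A\<close>.
\<close>

lemma act_power_series_inverse:
  fixes A C :: "'a::comm_ring_1 poly"
  assumes AC: "A * C = 1 - monom 1 m" and deg: "degree C < m"
  shows "act A (\<lambda>k. of_bool (k \<ge> 0) * act C (delta m) k) n = of_bool (n = 0)"
proof -
  define e0 :: "int \<Rightarrow> 'a" where "e0 = (\<lambda>k. of_bool (k = 0))"
  define v where "v = (\<lambda>k::int. of_bool (k \<ge> 0) * act C (delta m) k)"
  define w where "w = (\<lambda>k. act A v k - e0 k)"
  have v: "act (1 - monom 1 m) v k = act C e0 k" for k
  proof -
    have per: "act C (delta m) (k - int m) = (act C (delta m) k :: 'a)"
      by (rule act_delta_cong) (simp add: cong_iff_dvd_diff)
    consider "k < 0" | "0 \<le> k" "k < int m" | "k \<ge> int m"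
      by linarith
    thus ?thesis
    proof cases
      case 1
      thus ?thesis
        by (simp add: act_diff act_monom v_def e0_def act_impulse_neg)
    next
      case 2
      then obtain i where i: "k = int i" "i < m"
        by (metis nonneg_int_cases of_nat_less_iff)
      thus ?thesis
        using deg by (simp add: act_diff act_monom v_def e0_def act_impulse act_delta_coeff)
    next
      case 3
      then obtain i where i: "k = int i" "i \<ge> m"
        by (metis nonneg_int_cases of_nat_le_iff of_nat_0_le_iff order_trans)
      thus ?thesis
        using deg per by (simp add: act_diff act_monom v_def e0_def act_impulse coeff_eq_0)
    qed
  qed
  \<comment> \<open>The error \<open>w\<close> is therefore invariant under the shift by
    \<open>m\<close>; since it vanishes at negative indices, it vanishes everywhere.\<close>
  have "act (1 - monom 1 m) w k = 0" for k
  proof -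
    have "act (1 - monom 1 m) (act A v) k = act A (act C e0) k"
      by (simp only: act_commute[of _ A]) (simp only: ext[OF v])
    also have "\<dots> = act (1 - monom 1 m) e0 k"
      by (simp only: act_mult [symmetric] AC)
    finally show ?thesis
      by (simp only: w_def act_fun_diff diff_self)
  qed
  hence step: "w k = w (k - int m)" for k
    by (simp add: act_diff act_monom)
  have neg: "w k = 0" if "k < 0" for k
    using that by (simp add: w_def e0_def v_def act_def)
  have "w k = 0" for k
  proof (induction "nat (k + 1)" arbitrary: k rule: less_induct)
    case less
    show ?case
      using step[of k] neg[of k] less[of "k - int m"] deg by (cases "k < 0") auto
  qed
  from this[of n] show ?thesis
    by (simp add: w_def v_def e0_def)
qed

text \<open>Here \<open>g\<close> is \<open>h(x^s)\<close> times the power series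
  \<open>1 / A\<close>. Stopping at \<open>n div s\<close> keeps exactly the nonnegative arguments,
  where the series agrees with the periodic sequence.\<close>

lemma coeff_quotient_expansion:
  fixes A C g h :: "'a::comm_ring_1 poly"
  assumes AC: "A * C = 1 - monom 1 m" and deg: "degree C < m"
    and g: "g * A = pcompose h (monom 1 s)" and s: "s > 0"
  shows "coeff g n = (\<Sum>i\<le>n div s. coeff h i * act C (delta m) (int n - int (s * i)))"
proof -
  define v where "v = (\<lambda>k::int. of_bool (k \<ge> 0) * (act C (delta m) k :: 'a))"
  have "coeff g n = act g (\<lambda>k. of_bool (k = 0)) (int n)"
    by (simp add: act_impulse)
  also have "(\<lambda>k. of_bool (k = 0)) = act A v"
    using act_power_series_inverse[OF AC deg] unfolding v_def by presburger
  also have "act g (act A v) (int n) = (\<Sum>i\<le>degree h. coeff h i * v (int n - int (s * i)))"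
    by (simp only: act_mult [symmetric] g act_pcompose_monom)
  also have "\<dots> = (\<Sum>i\<le>max (degree h) (n div s). coeff h i * v (int n - int (s * i)))"
    by (rule sum.mono_neutral_left) (auto simp: coeff_eq_0)
  also have "\<dots> = (\<Sum>i\<le>n div s. coeff h i * v (int n - int (s * i)))"
  proof (rule sum.mono_neutral_right)
    show "\<forall>i\<in>{..max (degree h) (n div s)} - {..n div s}. coeff h i * v (int n - int (s * i)) = 0"
    proof
      fix i assume "i \<in> {..max (degree h) (n div s)} - {..n div s}"
      hence "n < s * i"
        using s by (simp add: div_less_iff_less_mult mult.commute not_le)
      hence "\<not> int n - int (s * i) \<ge> 0"
        by linarith
      thus "coeff h i * v (int n - int (s * i)) = 0"
        by (simp add: v_def)
    qed
  qed auto
  also have "\<dots> = (\<Sum>i\<le>n div s. coeff h i * act C (delta m) (int n - int (s * i)))"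
  proof (rule sum.cong [OF refl])
    fix i assume "i \<in> {..n div s}"
    hence "s * i \<le> n"
      using s by (simp add: less_eq_div_iff_mult_less_eq mult.commute)
    hence "int n - int (s * i) \<ge> 0"
      by linarith
    thus "coeff h i * v (int n - int (s * i)) = coeff h i * act C (delta m) (int n - int (s * i))"
      by (simp add: v_def)
  qed
  finally show ?thesis .
qed

subsection \<open>Truncations of binary cyclotomic polynomials\<close>

text \<open>Used with \<open>e = 1\<close> for the palindromic \<open>B\<close> and with
  \<open>e = -1\<close> for the antipalindromic \<open>C\<close>.\<close>

lemma act_reflect:
  assumes "\<And>i. i \<le> degree A \<Longrightarrow> coeff A (degree A - i) = e * coeff A i"
  shows "act A u (N + int (degree A) - n) = e * act A (\<lambda>k. u (N - k)) n"
proof -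
  have "act A u (N + int (degree A) - n) =
      (\<Sum>i\<le>degree A. coeff A (degree A - i) * u (N + int (degree A) - n - int (degree A - i)))"
    unfolding act_def by (rule sum.nat_diff_reindex[symmetric, of _ "Suc (degree A)", simplified lessThan_Suc_atMost, simplified])
  also have "\<dots> = (\<Sum>i\<le>degree A. e * (coeff A i * u (N - (n - int i))))"
  proof (rule sum.cong [OF refl])
    fix i assume i: "i \<in> {..degree A}"
    hence "N + int (degree A) - n - int (degree A - i) = N - (n - int i)"
      by (simp add: of_nat_diff)
    thus "coeff A (degree A - i) * u (N + int (degree A) - n - int (degree A - i)) =
        e * (coeff A i * u (N - (n - int i)))"
      using assms i by (simp only: mult.assoc atMost_iff)
  qed
  finally show ?thesis
    by (simp add: act_def sum_distrib_left)
qed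

lemma geometric_poly: "(1 - monom 1 1) * (\<Sum>i<n. monom 1 i) = (1 - monom 1 n :: 'a::comm_ring_1 poly)"
  using one_diff_power_eq[of "monom 1 1 :: 'a poly" n] by (simp add: monom_power)

lemma reflect_poly_one_minus_monom:
  assumes "n > 0"
  shows "reflect_poly (1 - monom 1 n :: 'a::comm_ring_1 poly) = - (1 - monom 1 n)"
proof -
  have deg: "degree (1 - monom 1 n :: 'a poly) = n"
  proof (rule antisym)
    show "degree (1 - monom 1 n :: 'a poly) \<le> n"
      by (rule degree_diff_le) (auto simp: degree_monom_le)
    show "n \<le> degree (1 - monom 1 n :: 'a poly)"
      by (rule le_degree) (use assms in simp)
  qed
  show ?thesis
    by (rule poly_eqI) (use assms in \<open>auto simp: coeff_reflect_poly deg\<close>)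
qed

lemma one_minus_monom_nonzero:
  assumes "n > 0"
  shows "1 - monom 1 n \<noteq> (0 :: 'a::comm_ring_1 poly)"
proof -
  have "coeff (1 - monom 1 n :: 'a poly) 0 = 1"
    using assms by simp
  thus ?thesis
    by (metis coeff_0 zero_neq_one)
qed

section \<open>The polynomial B, its cofactor C and the symmetries of F\<close>

locale binary_cyclotomic =
  fixes p q :: nat and B :: "complex poly"
  assumes p_ge_2: "p \<ge> 2" and p_less_q: "p < q" and coprime_pq: "coprime p q"
    and B_eq: "B * ((\<Sum>i<p. monom 1 i) * (1 - monom 1 q)) = 1 - monom 1 (p * q)"
begin

definition C :: "complex poly" where "C = (\<Sum>i<p. monom 1 i) * (1 - monom 1 q)"

definition c :: "int \<Rightarrow> complex" where "c = act C (delta (p * q))"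

text \<open>By \<open>C_alt\<close> the sequence \<open>c\<close> is a difference of two copies of
  \<open>box\<close> at distance \<open>p\<close>, and \<open>box\<close> itself is a sum of shifted
  impulses; both facts make sums over \<open>c\<close> telescope.\<close>

definition box :: "int \<Rightarrow> complex" where "box = act (\<Sum>i<q. monom 1 i) (delta (p * q))"

definition partial :: "nat \<Rightarrow> (int \<Rightarrow> complex) \<Rightarrow> int \<Rightarrow> complex" where
  "partial a u n = (\<Sum>j<a. coeff B j * u (n - int j))"

definition F :: "nat \<Rightarrow> nat \<Rightarrow> int \<Rightarrow> complex" where
  "F a a' n = partial a (partial a' c) n"

lemma q_less_pq: "p + q < p * q + 1" "p + q \<le> p * q"
proof -
  have "2 * q \<le> p * q" using p_ge_2 by simp
  thus "p + q < p * q + 1" "p + q \<le> p * q" using p_less_q by linarith+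
qed

lemma q_pos: "q > 0" and p_pos: "p > 0"
  using p_ge_2 p_less_q by auto

lemma BC: "B * C = 1 - monom 1 (p * q)"
  using B_eq by (simp add: C_def)

lemma coeff_geometric: "coeff (\<Sum>i<m. monom 1 i) n = (of_bool (n < m) :: complex)"
  by (simp add: coeff_sum)

lemma coeff_C: "coeff C n = of_bool (n < p) - of_bool (q \<le> n \<and> n < q + p)"
  unfolding C_def right_diff_distrib coeff_diff mult_1_right coeff_geometric
  by (subst mult.commute) (auto simp: coeff_monom_mult coeff_geometric of_bool_def)

lemma degree_C: "degree C = p + q - 1"
proof (rule antisym)
  show "degree C \<le> p + q - 1"
    by (rule degree_le) (use p_less_q p_ge_2 in \<open>auto simp: coeff_C\<close>)
  show "p + q - 1 \<le> degree C"
    by (rule le_degree) (use p_less_q p_ge_2 in \<open>auto simp: coeff_C\<close>)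
qed

lemma degree_C_less: "degree C < p * q"
  using q_less_pq p_pos by (simp add: degree_C)

lemma B_nonzero: "B \<noteq> 0" and C_nonzero: "C \<noteq> 0"
proof -
  have "coeff (1 - monom 1 (p * q) :: complex poly) 0 = 1"
    using q_pos p_pos by simp
  hence "B * C \<noteq> 0"
    unfolding BC by force
  thus "B \<noteq> 0" "C \<noteq> 0" by auto
qed

lemma degree_B: "degree B + (p + q) = p * q + 1"
proof -
  have "degree (1 - monom 1 (p * q) :: complex poly) = p * q"
  proof (rule antisym)
    show "degree (1 - monom 1 (p * q) :: complex poly) \<le> p * q"
      by (rule degree_diff_le) (auto simp: degree_monom_le)
    show "p * q \<le> degree (1 - monom 1 (p * q) :: complex poly)"
      by (rule le_degree) (use p_pos q_pos in simp)
  qed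
  thus ?thesis
    using degree_mult_eq[OF B_nonzero C_nonzero] p_pos unfolding BC degree_C by simp
qed

lemma coeff_B_0: "coeff B 0 = 1"
proof -
  have "coeff B 0 * coeff C 0 = 1"
    using arg_cong[OF BC, of "\<lambda>P. coeff P 0"] p_pos q_pos by (simp add: coeff_mult)
  thus ?thesis
    using p_pos q_pos by (simp add: coeff_C)
qed

lemma C_alt: "C = (\<Sum>i<q. monom 1 i) * (1 - monom 1 p)"
  unfolding C_def geometric_poly [symmetric, of p] geometric_poly [symmetric, of q]
  by (simp only: mult_ac)

lemma c_alt: "c n = box n - box (n - int p)"
proof -
  have "c n = act (1 - monom 1 p) box n"
    by (simp only: c_def C_alt box_def mult.commute[of "sum _ _"] act_mult)
  thus ?thesis
    by (simp add: act_diff act_monom)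
qed

lemma box_telescope: "box n - box (n - 1) = delta (p * q) n - delta (p * q) (n - int q)"
proof -
  have "act (1 - monom 1 1) box n = act (1 - monom 1 q) (delta (p * q)) n"
    by (simp only: box_def act_mult [symmetric] geometric_poly)
  thus ?thesis
    by (simp add: act_diff act_monom)
qed

lemma box_sum: "box n = (\<Sum>i<q. delta (p * q) (n - int i))"
  by (simp add: box_def act_sum act_monom)

lemma c_cong: "[i = j] (mod int (p * q)) \<Longrightarrow> c i = c j"
  unfolding c_def by (rule act_delta_cong)

lemma box_cong: "[i = j] (mod int (p * q)) \<Longrightarrow> box i = box j"
  unfolding box_def by (rule act_delta_cong)

lemma box_small: "0 \<le> n \<Longrightarrow> n < int (p * q) \<Longrightarrow> box n = of_bool (n < int q)"
proof -
  assume n: "0 \<le> n" "n < int (p * q)"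
  then obtain i where i: "n = int i" "i < p * q"
    by (metis nonneg_int_cases of_nat_less_iff)
  have "degree (\<Sum>i<q. monom 1 i :: complex poly) \<le> q - 1"
    by (rule degree_le) (auto simp: coeff_geometric)
  hence "degree (\<Sum>i<q. monom 1 i :: complex poly) < p * q"
    using q_less_pq q_pos p_pos by linarith
  thus ?thesis
    using i unfolding box_def by (simp add: act_delta_coeff coeff_geometric)
qed

lemma c_nonneg:
  assumes "0 \<le> v" "v < int (p * q)"
  shows "c v = of_bool (v < int p) - of_bool (int q \<le> v \<and> v < int q + int p)"
proof -
  obtain i where i: "v = int i" "i < p * q"
    using assms by (metis nonneg_int_cases of_nat_less_iff)
  have "c v = coeff C i"
    unfolding c_def i using i degree_C_less by (simp add: act_delta_coeff)
  thus ?thesis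
    using i by (simp add: coeff_C of_bool_def)
qed

text \<open>The gap: \<open>C\<close> has degree \<open>p + q - 1\<close>, and the zeros from
  \<open>p + q\<close> to the end of the period are, one period earlier, the indices from
  \<open>1 - degree B\<close> to -1.\<close>

lemma c_neg:
  assumes "- int (degree B) < v" "v < 0"
  shows "c v = 0"
proof -
  have "c v = c (v + int (p * q))"
    by (rule c_cong) (simp add: cong_iff_dvd_diff)
  moreover have "int (p + q) \<le> v + int (p * q)"
    using assms degree_B by linarith
  ultimately show ?thesis
    using assms p_less_q by (subst (asm) c_nonneg) auto
qed

lemma act_B_c: "act B c n = 0"
proof -
  have "delta (p * q) (n - int (p * q)) = (delta (p * q) n :: complex)"
    by (rule delta_cong) (simp add: cong_iff_dvd_diff)
  thus ?thesis
    unfolding c_def by (simp add: act_mult [symmetric] BC act_diff act_monom)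
qed

text \<open>In \<open>B (1 - x^p) (1 - x^q) = (1 - x) (1 - x^(p q))\<close> each binomial changes
  sign under reflection, and there are two on either side.\<close>

lemma reflect_B: "reflect_poly B = B"
proof -
  have eq: "B * ((1 - monom 1 p) * (1 - monom 1 q)) = (1 - monom 1 1) * (1 - monom 1 (p * q))"
    unfolding BC [symmetric] C_def geometric_poly [symmetric, of p] by (simp add: mult_ac)
  have "reflect_poly B * ((1 - monom 1 p) * (1 - monom 1 q)) = (1 - monom 1 1) * (1 - monom 1 (p * q))"
    using arg_cong[OF eq, of reflect_poly] p_pos q_pos
    by (simp only: reflect_poly_mult reflect_poly_one_minus_monom minus_mult_minus zero_less_one
        nat_0_less_mult_iff simp_thms)
  moreover have "(1 - monom 1 p) * (1 - monom 1 q) \<noteq> (0 :: complex poly)"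
    unfolding mult_eq_0_iff using one_minus_monom_nonzero[OF p_pos] one_minus_monom_nonzero[OF q_pos]
    by blast
  ultimately show ?thesis
    using eq by (metis mult_right_cancel)
qed

lemma coeff_B_reflect: "i \<le> degree B \<Longrightarrow> coeff B (degree B - i) = coeff B i"
  using arg_cong[OF reflect_B, of "\<lambda>P. coeff P i"] by (simp add: coeff_reflect_poly)

lemma coeff_C_reflect: "i \<le> degree C \<Longrightarrow> coeff C (degree C - i) = - 1 * coeff C i"
  using p_less_q p_ge_2 unfolding coeff_C degree_C by (auto simp: of_bool_def)

lemma c_reflect: "c (int (p + q) - 1 - v) = - c v"
proof -
  have "c (0 + int (degree C) - v) = - 1 * act C (\<lambda>k. delta (p * q) (0 - k)) v"
    unfolding c_def by (rule act_reflect) (rule coeff_C_reflect)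
  also have "(\<lambda>k. delta (p * q) (0 - k)) = (delta (p * q) :: int \<Rightarrow> complex)"
    by (simp add: delta_def fun_eq_iff)
  finally show ?thesis
    using p_pos by (simp add: c_def degree_C of_nat_diff)
qed

lemma partial_full: "a > degree B \<Longrightarrow> partial a u n = act B u n"
  unfolding partial_def act_def
  by (rule sum.mono_neutral_right) (auto simp: coeff_eq_0)

lemma partial_0 [simp]: "partial 0 u n = 0"
  by (simp add: partial_def)

lemma partial_Suc: "partial (Suc a) u n = partial a u n + coeff B a * u (n - int a)"
  by (simp add: partial_def)

lemma partial_Suc_0 [simp]: "partial (Suc 0) u n = u n"
  by (simp add: partial_def coeff_B_0)

lemma partial_act: "partial a (act A u) n = act A (partial a u) n"
  unfolding partial_def act_def
  by (simp add: sum_distrib_left mult_ac, subst sum.swap) (simp add: algebra_simps)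

lemma partial_commute: "partial a (partial a' u) n = partial a' (partial a u) n"
  unfolding partial_def
  by (simp add: sum_distrib_left mult_ac, subst sum.swap) (simp add: algebra_simps)

lemma F_commute: "F a a' n = F a' a n"
  unfolding F_def by (rule partial_commute)

lemma F_cong: "[n = n'] (mod int (p * q)) \<Longrightarrow> F a a' n = F a a' n'"
  unfolding F_def partial_def
  by (intro sum.cong refl arg_cong2[of _ _ _ _ "(*)"] c_cong cong_diff) auto

lemma act_B_partial: "act B (partial a c) n = 0"
  unfolding partial_act [symmetric] by (simp add: partial_def act_B_c)

lemma F_1: "F a 1 n = partial a c n"
  by (simp add: F_def partial_def coeff_B_0)

text \<open>A truncation beyond the degree is \<open>B\<close> itself, which annihilates
  \<open>c\<close> because \<open>1 - x^(p q)\<close> annihilates every sequence of period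
  \<open>p q\<close>.\<close>

lemma F_eq_0: "a = 0 \<or> a' = 0 \<or> a > degree B \<or> a' > degree B \<Longrightarrow> F a a' n = 0"
proof -
  have "F a a' n = 0" if "a = 0 \<or> a > degree B" for a a'
    using that by (auto simp: F_def partial_full act_B_partial)
  thus "a = 0 \<or> a' = 0 \<or> a > degree B \<or> a' > degree B \<Longrightarrow> F a a' n = 0"
    by (metis F_commute)
qed

text \<open>As \<open>B\<close> is palindromic, its terms from index \<open>a\<close> on, read
  backwards, form an initial segment of length \<open>degree B + 1 - a\<close>.\<close>

lemma partial_complement:
  assumes "a \<le> degree B + 1"
  shows "(\<Sum>j<degree B + 1 - a. coeff B j * u (n + int j)) =
    act B u (n + int (degree B)) - partial a u (n + int (degree B))"
proof -
  let ?d = "degree B"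
  have "act B u (n + int ?d) = (\<Sum>j<?d + 1. coeff B j * u (n + int ?d - int j))"
    unfolding act_def by (rule sum.cong) auto
  also have "{..<?d + 1} = {..<a} \<union> {a..<?d + 1}"
    using assms by auto
  also have "(\<Sum>j\<in>{..<a} \<union> {a..<?d + 1}. coeff B j * u (n + int ?d - int j)) =
      partial a u (n + int ?d) + (\<Sum>j\<in>{a..<?d + 1}. coeff B j * u (n + int ?d - int j))"
    unfolding partial_def by (rule sum.union_disjoint) auto
  also have "(\<Sum>j\<in>{a..<?d + 1}. coeff B j * u (n + int ?d - int j)) =
      (\<Sum>j<?d + 1 - a. coeff B j * u (n + int j))"
  proof (rule sum.reindex_bij_witness[of _ "\<lambda>j. ?d - j" "\<lambda>j. ?d - j"])
    fix j assume j: "j \<in> {a..<?d + 1}"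
    hence "coeff B (?d - j) = coeff B j" "n + int (?d - j) = n + int ?d - int j"
      by (auto intro: coeff_B_reflect)
    thus "coeff B (?d - j) * u (n + int (?d - j)) = coeff B j * u (n + int ?d - int j)"
      by (simp only:)
  qed auto
  finally show ?thesis
    by simp
qed

lemma partial_reflect:
  assumes "a \<le> degree B + 1" "\<And>k. act B u k = 0"
  shows "partial (degree B + 1 - a) (\<lambda>k. u (N - k)) n = - partial a u (N - n + int (degree B))"
proof -
  have "partial (degree B + 1 - a) (\<lambda>k. u (N - k)) n =
      (\<Sum>j<degree B + 1 - a. coeff B j * u ((N - n) + int j))"
    unfolding partial_def by (simp add: algebra_simps)
  thus ?thesis
    using partial_complement[OF assms(1), of u "N - n"] assms(2) by simp
qed

text \<open>Each complementation costs a sign because \<open>B\<close> annihilates the sequence it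
  is applied to; a third sign comes from the antisymmetry of \<open>c\<close>.\<close>

lemma F_reflect:
  assumes "a \<le> degree B + 1" "a' \<le> degree B + 1"
  shows "F (degree B + 1 - a) (degree B + 1 - a') n =
    - F a a' (int (2 * degree B + p + q) - 1 - n)"
proof -
  let ?d = "degree B"
  have c: "c = (\<lambda>k. - c (int (p + q) - 1 - k))"
    by (simp only: c_reflect minus_minus)
  have neg: "partial b (\<lambda>k. - u k) n = - partial b u n" for b u n
    by (simp add: partial_def sum_negf)
  have "partial (?d + 1 - a') c = (\<lambda>k. partial a' c (int (p + q) - 1 + int ?d - k))"
    by (subst c, rule ext) (simp only: neg partial_reflect[OF assms(2) act_B_c], simp add: algebra_simps)
  hence "F (?d + 1 - a) (?d + 1 - a') n =
      partial (?d + 1 - a) (\<lambda>k. partial a' c (int (p + q) - 1 + int ?d - k)) n"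
    by (simp only: F_def)
  also have "\<dots> = - partial a (partial a' c) (int (p + q) - 1 + int ?d - n + int ?d)"
    by (rule partial_reflect[OF assms(1) act_B_partial])
  finally show ?thesis
    by (simp add: F_def algebra_simps)
qed

end

subsection \<open>Reduction of the quaternary case to \<open>F\<close>\<close>

lemma pcompose_monom_monom: "pcompose (monom 1 n) (monom 1 r) = (monom 1 (n * r) :: 'a::comm_ring_1 poly)"
  by (induction n) (simp_all add: monom_Suc pcompose_pCons pcompose_1 mult_monom)

lemma act_poly_cutoff: "act (poly_cutoff (Suc k) A) u n = (\<Sum>i\<le>k. coeff A i * u (n - int i))"
proof -
  have "degree (poly_cutoff (Suc k) A) \<le> k"
    by (rule degree_le) (simp add: coeff_poly_cutoff)
  thus ?thesis
    by (simp add: act_extend coeff_poly_cutoff)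
qed

context binary_cyclotomic
begin

lemma sum_coeff_B_tail: "(\<Sum>h=L..degree B. coeff B h * u (n - int h)) = act B u n - partial L u n"
proof -
  have "act B u n = (\<Sum>h\<in>{..<L} \<union> {L..degree B}. coeff B h * u (n - int h))"
    unfolding act_def by (rule sum.mono_neutral_left) (auto simp: coeff_eq_0)
  also have "\<dots> = partial L u n + (\<Sum>h=L..degree B. coeff B h * u (n - int h))"
    unfolding partial_def by (rule sum.union_disjoint) auto
  finally show ?thesis
    by simp
qed

text \<open>Compare with the power series \<open>1 / B\<close>, on which all of \<open>B\<close>
  produces the impulse. For \<open>v < a\<close> the omitted terms have negative arguments; for
  \<open>v\<close> at least \<open>a - degree B\<close> all negative arguments that occur lie in the
  gap of \<open>c\<close>.\<close>

lemma partial_c_small: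
  assumes "int a - int (degree B) \<le> v" "v < int a"
  shows "partial a c v = of_bool (v = 0)"
proof -
  let ?u = "\<lambda>k. of_bool (k \<ge> 0) * act C (delta (p * q)) k"
  have "of_bool (v = 0) = act B ?u v"
    by (rule act_power_series_inverse[OF BC degree_C_less, symmetric])
  also have "\<dots> = partial (max a (Suc (degree B))) ?u v"
    by (rule partial_full [symmetric]) simp
  also have "\<dots> = partial a ?u v"
    unfolding partial_def
    by (rule sum.mono_neutral_right) (use assms in auto)
  also have "\<dots> = partial a c v"
    unfolding partial_def
  proof (rule sum.cong [OF refl])
    fix j assume "j \<in> {..<a}"
    hence "- int (degree B) < v - int j"
      using assms by simp
    hence "?u (v - int j) = c (v - int j)"
      using c_neg[of "v - int j"] by (auto simp: c_def)
    thus "coeff B j * ?u (v - int j) = coeff B j * c (v - int j)"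
      by simp
  qed
  finally show ?thesis ..
qed

text \<open>The values of \<open>F\<close> at the coefficients of the ternary product whose index is a multiple of \<open>r\<close>.\<close>

lemma F_diag:
  assumes "1 \<le> a" "1 \<le> L" "L \<le> degree B"
  shows "F a L (int a) = (if a < L then 0 else - coeff B a)"
proof -
  have "F a L (int a) = (\<Sum>h<L. coeff B h * partial a c (int a - int h))"
    unfolding F_commute[of a L] by (simp add: F_def partial_def[of L])
  also have "\<dots> = (\<Sum>h<L. (if h = a then coeff B a else 0) - (if h = 0 then coeff B a else 0))"
  proof (rule sum.cong [OF refl])
    fix h assume h: "h \<in> {..<L}"
    \<comment> \<open>The index \<open>a\<close> lies just outside the window of
      \<open>partial_c_small\<close>. One more term moves it inside, where the value is 0; that term
      is \<open>coeff B a\<close>, as \<open>c 0 = 1\<close>.\<close>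
    have "partial a c (int a) = - coeff B a"
      using partial_c_small[of "Suc a" "int a"] partial_Suc[of a c "int a"] c_nonneg[of 0]
        assms p_pos q_pos by (simp add: eq_neg_iff_add_eq_0)
    moreover have "partial a c (int a - int h) = of_bool (h = a)" if "h > 0"
      using that assms h by (subst partial_c_small) auto
    ultimately show "coeff B h * partial a c (int a - int h) =
        (if h = a then coeff B a else 0) - (if h = 0 then coeff B a else 0)"
      using assms coeff_B_0 by (cases "h = 0") auto
  qed
  also have "\<dots> = (if a < L then 0 else - coeff B a)"
    using assms by (simp add: sum_subtractf)
  finally show ?thesis .
qed

text \<open>The counterpart of \<open>F_diag\<close> for \<open>r\<close> congruent to -1, where the
  index that matters is \<open>a - 1\<close>. All arguments now lie inside the window of
  \<open>partial_c_small\<close>.\<close>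

lemma F_subdiag:
  assumes "1 \<le> a" "L \<le> degree B"
  shows "F a L (int a - 1) = (if a - 1 < L then coeff B (a - 1) else 0)"
proof -
  have "F a L (int a - 1) = (\<Sum>h<L. coeff B h * partial a c (int a - 1 - int h))"
    unfolding F_commute[of a L] by (simp add: F_def partial_def[of L])
  also have "\<dots> = (\<Sum>h<L. if h = a - 1 then coeff B (a - 1) else 0)"
  proof (rule sum.cong [OF refl])
    fix h assume h: "h \<in> {..<L}"
    hence "partial a c (int a - 1 - int h) = of_bool (int a - 1 - int h = 0)"
      using assms by (intro partial_c_small) auto
    thus "coeff B h * partial a c (int a - 1 - int h) = (if h = a - 1 then coeff B (a - 1) else 0)"
      using assms by auto
  qed
  also have "\<dots> = (if a - 1 < L then coeff B (a - 1) else 0)"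
    by simp
  finally show ?thesis .
qed

end

section \<open>Coefficients of g through truncations of f\<close>

locale quaternary_cyclotomic = binary_cyclotomic +
  fixes r s :: nat and f g :: "complex poly"
  assumes r_ge: "r \<ge> p * q"
    and r_cong: "[int r = 1] (mod int (p * q)) \<or> [int r = - 1] (mod int (p * q))"
    and f_eq: "f * B = pcompose B (monom 1 r)"
    and s_ge: "s \<ge> p * q * r"
    and s_cong: "[int s = 1] (mod int (p * q * r)) \<or> [int s = - 1] (mod int (p * q * r))"
    and g_eq: "g * f = pcompose f (monom 1 s)"
begin

text \<open>The cofactor of \<open>f\<close> in \<open>1 - x^(p q r)\<close>, because
  \<open>f B C(x^r) = B(x^r) C(x^r)\<close>.\<close>

definition C' :: "complex poly" where "C' = B * pcompose C (monom 1 r)"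

definition c_dil :: "int \<Rightarrow> complex" where
  "c_dil v = (if int r dvd v then c (v div int r) else 0)"

text \<open>The factor \<open>B\<close> of \<open>C'\<close> is joined to the truncation of
  \<open>f\<close> since \<open>f B = B(x^r)\<close> is sparse; the truncation disturbs this only
  beyond index \<open>k\<close>.\<close>

definition W :: "nat \<Rightarrow> complex poly" where "W k = poly_cutoff (Suc k) f * B"

lemma r_gt: "r > degree B"
  using r_ge degree_B p_ge_2 by linarith

lemma r_pos: "r > 0"
  using r_gt by simp

lemma s_pos: "s > 0"
  using s_ge p_pos q_pos r_pos by (metis mult_pos_pos neq0_conv not_le)

lemma f_C': "f * C' = 1 - monom 1 (p * q * r)"
proof -
  have "f * C' = pcompose B (monom 1 r) * pcompose C (monom 1 r)"
    by (simp only: C'_def mult.assoc [symmetric] f_eq)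
  also have "\<dots> = 1 - monom 1 (p * q * r)"
    by (simp only: pcompose_mult [symmetric] BC pcompose_diff pcompose_1 pcompose_monom_monom)
  finally show ?thesis .
qed

lemma degree_C': "degree C' < p * q * r"
proof -
  have "degree C' \<le> degree B + degree (pcompose C (monom 1 r))"
    unfolding C'_def by (rule degree_mult_le)
  also have "degree (pcompose C (monom 1 r)) \<le> degree C * degree (monom 1 r :: complex poly)"
    by (rule degree_pcompose_le)
  also have "\<dots> \<le> degree C * r"
    by (intro mult_left_mono degree_monom_le) simp
  finally have "degree C' < (degree C + 1) * r"
    using r_gt by simp
  also have "\<dots> \<le> p * q * r"
    using degree_C_less by (intro mult_right_mono) auto
  finally show ?thesis .
qed

lemma act_C_dilated: "act (pcompose C (monom 1 r)) (delta (p * q * r)) v = c_dil v"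
proof (cases "int r dvd v")
  case True
  then obtain w where w: "v = int r * w" ..
  have "delta (p * q * r) (v - int (r * i)) = (delta (p * q) (w - int i) :: complex)" for i
  proof -
    have "v - int (r * i) = int r * (w - int i)" "int (p * q * r) = int r * int (p * q)"
      by (simp_all add: w algebra_simps)
    thus ?thesis
      using r_pos by (simp only: delta_def) simp
  qed
  hence "act (pcompose C (monom 1 r)) (delta (p * q * r)) v = c w"
    unfolding act_pcompose_monom c_def act_def[of C] by (simp only:)
  thus ?thesis
    using r_pos by (simp add: c_dil_def w)
next
  case False
  have "delta (p * q * r) (v - int (r * i)) = (0 :: complex)" for i
  proof -
    have "\<not> int r dvd v - int (r * i)"
      using False by (simp add: dvd_diff_left_iff)
    hence "\<not> int (p * q * r) dvd v - int (r * i)"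
      by (meson dvd_trans dvd_triv_right of_nat_dvd_iff)
    thus ?thesis
      by (simp add: delta_def)
  qed
  with False show ?thesis
    by (simp add: act_pcompose_monom c_dil_def)
qed

lemma act_C'_delta: "act C' (delta (p * q * r)) = act B c_dil"
  by (rule ext) (simp only: C'_def act_mult act_C_dilated[THEN ext])

lemma c_dil_reflect: "c_dil (int (r * (p + q - 1)) - v) = - c_dil v"
proof -
  have eq: "int (r * (p + q - 1)) = int r * (int (p + q) - 1)"
    using p_pos by (simp add: of_nat_diff)
  have "c ((int r * (int (p + q) - 1) - v) div int r) = - c (v div int r)" if v: "int r dvd v"
  proof -
    obtain w where w: "v = int r * w"
      using v ..
    have "(int r * (int (p + q) - 1) - v) div int r = int (p + q) - 1 - w"
      using r_pos by (simp only: w right_diff_distrib [symmetric]) simp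
    thus ?thesis
      using r_pos by (simp only: c_reflect w) simp
  qed
  thus ?thesis
    unfolding c_dil_def eq by (auto simp: dvd_diff_right_iff)
qed

lemma act_B_c_dil_reflect:
  "act B c_dil (int (r * (p + q - 1)) + int (degree B) - n) = - act B c_dil n"
proof -
  have "act B c_dil (int (r * (p + q - 1)) + int (degree B) - n) =
      1 * act B (\<lambda>k. c_dil (int (r * (p + q - 1)) - k)) n"
    by (rule act_reflect) (simp add: coeff_B_reflect)
  also have "\<dots> = - act B c_dil n"
    unfolding c_dil_reflect by (simp add: act_def sum_negf)
  finally show ?thesis .
qed

lemma act_W: "act (W k) c_dil t = (\<Sum>i\<le>k. coeff f i * act B c_dil (t - int i))"
  by (simp add: W_def act_mult act_poly_cutoff)

lemma coeff_g_eq: "coeff g n = (\<Sum>i\<le>n div s. coeff f i * act B c_dil (int n - int (s * i)))"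
  using coeff_quotient_expansion[OF f_C' degree_C' g_eq s_pos] by (simp only: act_C'_delta)

lemma act_B_c_dil_cong: "[i = j] (mod int (p * q * r)) \<Longrightarrow> act B c_dil i = act B c_dil j"
  unfolding act_C'_delta [symmetric] by (rule act_delta_cong)

lemma act_W_cong:
  assumes "[t = t'] (mod int (p * q * r))"
  shows "act (W k) c_dil t = act (W k) c_dil t'"
  unfolding act_W by (intro sum.cong refl arg_cong2[of _ _ _ _ "(*)"] act_B_c_dil_cong cong_diff assms cong_refl)

text \<open>Modulo \<open>p q r\<close> a shift by \<open>s i\<close> is a shift by \<open>i\<close>
  or by \<open>- i\<close>. In the second case the antisymmetry of \<open>act B c_dil\<close>
  restores the direction, at the price of a sign and a reversed index.\<close>

lemma coeff_g_W:
  "\<exists>e\<in>{1, -1}. \<forall>n. \<exists>t. coeff g n = e * act (W (n div s)) c_dil t \<and>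
    (e = 1 \<longrightarrow> t = int n) \<and> (e = -1 \<longrightarrow> t = int (r * (p + q - 1)) + int (degree B) - int n)"
  using s_cong
proof
  assume s1: "[int s = 1] (mod int (p * q * r))"
  have "coeff g n = act (W (n div s)) c_dil (int n)" for n
    unfolding coeff_g_eq act_W
  proof (intro sum.cong refl arg_cong2[of _ _ _ _ "(*)"] act_B_c_dil_cong cong_diff cong_refl)
    fix i show "[int (s * i) = int i] (mod int (p * q * r))"
      using cong_scalar_right[OF s1, of "int i"] by simp
  qed
  thus ?thesis
    by (intro bexI[of _ 1]) auto
next
  assume s1: "[int s = - 1] (mod int (p * q * r))"
  have "coeff g n = - act (W (n div s)) c_dil (int (r * (p + q - 1)) + int (degree B) - int n)" for n
  proof -
    have "coeff g n = (\<Sum>i\<le>n div s. coeff f i * act B c_dil (int n - - int i))"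
      unfolding coeff_g_eq
    proof (intro sum.cong refl arg_cong2[of _ _ _ _ "(*)"] act_B_c_dil_cong cong_diff cong_refl)
      fix i show "[int (s * i) = - int i] (mod int (p * q * r))"
        using cong_scalar_right[OF s1, of "int i"] by simp
    qed
    also have "\<dots> = (\<Sum>i\<le>n div s. - (coeff f i *
        act B c_dil (int (r * (p + q - 1)) + int (degree B) - int n - int i)))"
    proof (rule sum.cong [OF refl])
      fix i
      have "int (r * (p + q - 1)) + int (degree B) - int n - int i =
          int (r * (p + q - 1)) + int (degree B) - (int n - - int i)"
        by simp
      thus "coeff f i * act B c_dil (int n - - int i) = - (coeff f i *
          act B c_dil (int (r * (p + q - 1)) + int (degree B) - int n - int i))"
        by (simp only: act_B_c_dil_reflect) simp
    qed
    finally show ?thesis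
      by (simp add: act_W sum_negf)
  qed
  thus ?thesis
    by (intro bexI[of _ "- 1"]) auto
qed

text \<open>Since \<open>s\<close> is at least \<open>p q r\<close>, the indices \<open>n\<close>
  with \<open>n div s = k\<close> cover all residues modulo \<open>p q r\<close>, so every value of
  \<open>act (W k) c_dil\<close> occurs up to sign.\<close>

lemma flat_iff_W:
  "(\<forall>n. cmod (coeff g n) \<le> 1) \<longleftrightarrow> (\<forall>k t. cmod (act (W k) c_dil t) \<le> 1)"
proof -
  obtain e :: complex where e: "e \<in> {1, -1}" and g: "\<And>n. \<exists>t. coeff g n = e * act (W (n div s)) c_dil t \<and>
    (e = 1 \<longrightarrow> t = int n) \<and> (e = -1 \<longrightarrow> t = int (r * (p + q - 1)) + int (degree B) - int n)"
    using coeff_g_W by blast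
  have ne: "cmod (e * z) = cmod z" for z
    using e by (auto simp: norm_mult)
  show ?thesis
  proof
    assume "\<forall>k t. cmod (act (W k) c_dil t) \<le> 1"
    thus "\<forall>n. cmod (coeff g n) \<le> 1"
      using g ne by metis
  next
    assume flat: "\<forall>n. cmod (coeff g n) \<le> 1"
    show "\<forall>k t. cmod (act (W k) c_dil t) \<le> 1"
    proof (intro allI)
      fix k t
      define t' where "t' = (if e = 1 then t else int (r * (p + q - 1)) + int (degree B) - t)"
      define M where "M = int (p * q * r)"
      define j where "j = nat ((t' - int (s * k)) mod M)"
      have M: "M > 0"
        using p_pos q_pos r_pos by (simp add: M_def)
      have j: "int j = (t' - int (s * k)) mod M" "int j < M"
        using M by (simp_all add: j_def)
      hence "j < s"
        using s_ge unfolding M_def by linarith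
      hence div: "(s * k + j) div s = k"
        using s_pos by simp
      have cong: "[int (s * k + j) = t'] (mod M)"
        using j by (simp add: cong_def mod_simps)
      obtain t2 where t2: "coeff g (s * k + j) = e * act (W k) c_dil t2"
        "e = 1 \<longrightarrow> t2 = int (s * k + j)"
        "e = -1 \<longrightarrow> t2 = int (r * (p + q - 1)) + int (degree B) - int (s * k + j)"
        using g[of "s * k + j"] unfolding div by blast
      have "[t2 = t] (mod M)"
      proof (cases "e = 1")
        case True
        thus ?thesis
          using t2(2) cong by (simp add: t'_def)
      next
        case False
        hence "e = -1"
          using e by simp
        hence "t2 = int (r * (p + q - 1)) + int (degree B) - int (s * k + j)"
          using t2(3) by blast
        moreover have "t = int (r * (p + q - 1)) + int (degree B) - t'"
          using False by (simp add: t'_def)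
        ultimately show ?thesis
          using cong by (simp only:) (rule cong_diff[OF cong_refl])
      qed
      hence "act (W k) c_dil t = act (W k) c_dil t2"
        unfolding M_def by (metis act_W_cong)
      thus "cmod (act (W k) c_dil t) \<le> 1"
        using flat t2(1) ne by metis
    qed
  qed
qed

end

section \<open>Truncations of f times B in terms of F\<close>

context quaternary_cyclotomic
begin

lemma coeff_f_eq: "coeff f i = (\<Sum>j\<le>i div r. coeff B j * c (int i - int (r * j)))"
  using coeff_quotient_expansion[OF BC degree_C_less f_eq r_pos] by (simp only: c_def)

text \<open>The range of summation depends on \<open>k\<close> and not on \<open>v\<close>, since
  the additional terms fall into the gap of \<open>c\<close>. With a uniform range the sums in
  \<open>coeff_W_high\<close> can be exchanged.\<close>

lemma coeff_f_int:
  assumes "int k - int (degree B) < v" "v \<le> int k"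
  shows "(\<Sum>j\<le>k div r. coeff B j * c (v - int (r * j))) = of_bool (v \<ge> 0) * coeff f (nat v)"
proof -
  have vanish: "c (v - int (r * j)) = 0" if "j \<le> k div r" "v < int (r * j)" for j
  proof (rule c_neg)
    have "r * j \<le> k"
      using that r_pos by (simp add: less_eq_div_iff_mult_less_eq mult.commute)
    hence "int (r * j) \<le> int k"
      by (simp only: of_nat_le_iff)
    thus "- int (degree B) < v - int (r * j)"
      using assms by linarith
    show "v - int (r * j) < 0"
      using that by linarith
  qed
  show ?thesis
  proof (cases "v \<ge> 0")
    case False
    have "v < int (r * j)" for j
      using False by (smt (verit) of_nat_0_le_iff)
    thus ?thesis
      using False vanish by simp
  next
    case True
    then obtain i where i: "v = int i" "i \<le> k"
      using assms by (metis nonneg_int_cases of_nat_le_iff)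
    have "(\<Sum>j\<le>k div r. coeff B j * c (v - int (r * j))) =
        (\<Sum>j\<le>i div r. coeff B j * c (v - int (r * j)))"
    proof (rule sum.mono_neutral_right)
      show "{..i div r} \<subseteq> {..k div r}"
        using i by (simp add: div_le_mono)
      show "\<forall>j\<in>{..k div r} - {..i div r}. coeff B j * c (v - int (r * j)) = 0"
      proof
        fix j assume j: "j \<in> {..k div r} - {..i div r}"
        hence "i < r * j"
          using r_pos by (simp add: div_less_iff_less_mult mult.commute not_le)
        thus "coeff B j * c (v - int (r * j)) = 0"
          using vanish[of j] j i by (simp del: of_nat_mult)
      qed
    qed simp
    thus ?thesis
      using i by (simp add: coeff_f_eq)
  qed
qed

lemma degree_W: "degree (W k) \<le> k + degree B"
proof -
  have "degree (poly_cutoff (Suc k) f) \<le> k"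
    by (rule degree_le) (simp add: coeff_poly_cutoff)
  thus ?thesis
    unfolding W_def by (meson add_right_mono degree_mult_le order_trans)
qed

lemma coeff_W_low:
  assumes "N \<le> k"
  shows "coeff (W k) N = (if r dvd N then coeff B (N div r) else 0)"
proof -
  have "coeff (W k) N = coeff (f * B) N"
    unfolding W_def coeff_mult using assms by (intro sum.cong refl) (auto simp: coeff_poly_cutoff)
  thus ?thesis
    using r_pos by (simp add: f_eq coeff_pcompose_monom)
qed

text \<open>Only terms of \<open>B\<close> from index \<open>N - k\<close> on meet the truncated
  \<open>f\<close>. Applied to \<open>c\<close>, this tail of \<open>B\<close> is minus the initial
  segment, because \<open>B\<close> annihilates \<open>c\<close>.\<close>

lemma coeff_W_high:
  assumes "k < N"
  shows "coeff (W k) N = - (\<Sum>j\<le>k div r. coeff B j * partial (N - k) c (int N - int (r * j)))"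
proof -
  let ?e = "\<lambda>k::int. of_bool (k = 0) :: complex"
  let ?A = "poly_cutoff (Suc k) f"
  let ?L = "N - k"
  have "coeff (W k) N = act B (act ?A ?e) (int N)"
    by (simp only: act_impulse [symmetric] W_def act_mult [symmetric] mult.commute)
  also have "\<dots> = (\<Sum>h=?L..degree B. coeff B h * act ?A ?e (int N - int h))"
    unfolding act_def[of B]
  proof (rule sum.mono_neutral_right)
    show "\<forall>h\<in>{..degree B} - {?L..degree B}. coeff B h * act ?A ?e (int N - int h) = 0"
    proof
      fix h assume "h \<in> {..degree B} - {?L..degree B}"
      hence h: "h < N - k"
        by auto
      hence "int N - int h = int (N - h)" "N - h > k"
        by auto
      thus "coeff B h * act ?A ?e (int N - int h) = 0"
        by (simp only: act_impulse) (simp add: coeff_poly_cutoff)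
    qed
  qed auto
  also have "\<dots> = (\<Sum>h=?L..degree B. coeff B h *
      (\<Sum>j\<le>k div r. coeff B j * c (int N - int h - int (r * j))))"
  proof (rule sum.cong [OF refl])
    fix h assume h: "h \<in> {?L..degree B}"
    have eq: "act ?A ?e (int N - int h) =
        of_bool (int N - int h \<ge> 0) * coeff f (nat (int N - int h))"
    proof (cases "h \<le> N")
      case True
      hence eq: "int N - int h = int (N - h)"
        by (simp add: of_nat_diff)
      have "N - h < Suc k"
        using h by auto
      thus ?thesis
        unfolding eq act_impulse by (simp add: coeff_poly_cutoff)
    next
      case False
      thus ?thesis
        by (simp add: act_impulse_neg)
    qed
    have "(\<Sum>j\<le>k div r. coeff B j * c (int N - int h - int (r * j))) =
        of_bool (int N - int h \<ge> 0) * coeff f (nat (int N - int h))"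
      by (rule coeff_f_int) (use h assms in auto)
    thus "coeff B h * act ?A ?e (int N - int h) = coeff B h *
      (\<Sum>j\<le>k div r. coeff B j * c (int N - int h - int (r * j)))"
      using eq by simp
  qed
  also have "\<dots> = (\<Sum>j\<le>k div r. coeff B j *
      (\<Sum>h=?L..degree B. coeff B h * c (int N - int (r * j) - int h)))"
    by (simp add: sum_distrib_left mult_ac, subst sum.swap) (simp add: algebra_simps)
  also have "\<dots> = - (\<Sum>j\<le>k div r. coeff B j * partial ?L c (int N - int (r * j)))"
    unfolding sum_coeff_B_tail act_B_c by (simp add: sum_negf)
  finally show ?thesis .
qed

lemma partial_c_cong: "[i = j] (mod int (p * q)) \<Longrightarrow> partial L c i = partial L c j"
  unfolding partial_def
  by (intro sum.cong refl arg_cong2[of _ _ _ _ "(*)"] c_cong cong_diff cong_refl)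

lemma coeff_W_F_plus:
  assumes "k < N" "[int r = 1] (mod int (p * q))"
  shows "coeff (W k) N = - F (k div r + 1) (N - k) (int N)"
proof -
  have "partial (N - k) c (int N - int (r * j)) = partial (N - k) c (int N - int j)" for j
    using cong_scalar_right[OF assms(2), of "int j"]
    by (intro partial_c_cong cong_diff cong_refl) simp
  thus ?thesis
    by (simp add: coeff_W_high[OF assms(1)] F_def partial_def[of "Suc _"] lessThan_Suc_atMost)
qed

text \<open>Now \<open>j\<close> enters with the opposite sign, so the outer truncation is replaced
  by its complement.\<close>

lemma coeff_W_F_minus:
  assumes "k < N" "[int r = - 1] (mod int (p * q))"
  shows "coeff (W k) N = F (degree B - k div r) (N - k) (int N + int (degree B))"
proof -
  have "partial (N - k) c (int N - int (r * j)) = partial (N - k) c (int N + int j)" for j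
  proof (rule partial_c_cong)
    show "[int N - int (r * j) = int N + int j] (mod int (p * q))"
      using cong_diff[OF cong_refl cong_scalar_right[OF assms(2), of "int j"], of "int N"] by simp
  qed
  hence W: "coeff (W k) N = - (\<Sum>j\<le>k div r. coeff B j * partial (N - k) c (int N + int j))"
    by (simp add: coeff_W_high[OF assms(1)])
  \<comment> \<open>Truncated subtraction gives \<open>a = 0\<close> when \<open>k div r\<close> is
    at least \<open>degree B\<close>; the sum then runs over all of \<open>B\<close>.\<close>
  define a where "a = degree B - k div r"
  have "(\<Sum>j\<le>k div r. coeff B j * partial (N - k) c (int N + int j)) =
      (\<Sum>j<degree B + 1 - a. coeff B j * partial (N - k) c (int N + int j))"
    by (rule sum.mono_neutral_right) (auto simp: a_def coeff_eq_0)
  also have "\<dots> = - partial a (partial (N - k) c) (int N + int (degree B))"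
    by (subst partial_complement) (auto simp: a_def act_B_partial)
  finally show ?thesis
    using W by (simp add: F_def a_def)
qed

lemma act_W_eq:
  "act (W k) c_dil t = (if int r dvd t then partial (k div r + 1) c (t div int r) else 0) +
    (\<Sum>N=Suc k..k + degree B. coeff (W k) N * c_dil (t - int N))"
proof -
  have "act (W k) c_dil t = (\<Sum>N\<in>{..k} \<union> {Suc k..k + degree B}. coeff (W k) N * c_dil (t - int N))"
    unfolding act_extend[OF degree_W] by (rule sum.cong) auto
  also have "\<dots> = (\<Sum>N\<le>k. coeff (W k) N * c_dil (t - int N)) +
      (\<Sum>N=Suc k..k + degree B. coeff (W k) N * c_dil (t - int N))"
    by (rule sum.union_disjoint) auto
  also have "(\<Sum>N\<le>k. coeff (W k) N * c_dil (t - int N)) =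
      (\<Sum>j\<le>k div r. coeff B j * c_dil (t - int (r * j)))"
  proof -
    have "(\<Sum>N\<le>k. coeff (W k) N * c_dil (t - int N)) =
        (\<Sum>N\<in>(\<lambda>j. r * j) ` {..k div r}. coeff (W k) N * c_dil (t - int N))"
    proof (rule sum.mono_neutral_right)
      show "(\<lambda>j. r * j) ` {..k div r} \<subseteq> {..k}"
        using r_pos by (auto simp: less_eq_div_iff_mult_less_eq mult.commute)
      show "\<forall>N\<in>{..k} - (\<lambda>j. r * j) ` {..k div r}. coeff (W k) N * c_dil (t - int N) = 0"
      proof
        fix N assume N: "N \<in> {..k} - (\<lambda>j. r * j) ` {..k div r}"
        have "\<not> r dvd N"
        proof
          assume "r dvd N"
          hence "N = r * (N div r)" "N div r \<in> {..k div r}"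
            using N by (auto simp: div_le_mono)
          thus False
            using N by blast
        qed
        thus "coeff (W k) N * c_dil (t - int N) = 0"
          using N by (simp add: coeff_W_low)
      qed
    qed simp
    also have "\<dots> = (\<Sum>j\<le>k div r. coeff (W k) (r * j) * c_dil (t - int (r * j)))"
      using r_pos by (subst sum.reindex) (auto simp: inj_on_def)
    also have "\<dots> = (\<Sum>j\<le>k div r. coeff B j * c_dil (t - int (r * j)))"
    proof (rule sum.cong [OF refl])
      fix j assume "j \<in> {..k div r}"
      hence "r * j \<le> k"
        using r_pos by (simp add: less_eq_div_iff_mult_less_eq mult.commute)
      thus "coeff (W k) (r * j) * c_dil (t - int (r * j)) = coeff B j * c_dil (t - int (r * j))"
        using r_pos by (simp add: coeff_W_low)
    qed
    finally show ?thesis .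
  qed
  also have "\<dots> = (if int r dvd t then partial (k div r + 1) c (t div int r) else 0)"
  proof (cases "int r dvd t")
    case True
    then obtain w where w: "t = int r * w" ..
    have "c_dil (t - int (r * j)) = c (w - int j)" for j
    proof -
      have "t - int (r * j) = int r * (w - int j)"
        by (simp add: w algebra_simps)
      thus ?thesis
        using r_pos by (simp only: c_dil_def) simp
    qed
    thus ?thesis
      using r_pos w by (simp add: partial_def lessThan_Suc_atMost del: of_nat_mult)
  next
    case False
    have "\<not> int r dvd t - int (r * j)" for j
      using False by (simp add: dvd_diff_left_iff)
    thus ?thesis
      using False by (simp add: c_dil_def del: of_nat_mult)
  qed
  finally show ?thesis .
qed

text \<open>If \<open>r\<close> divides \<open>t\<close>, both parts of \<open>act_W_eq\<close> can
  contribute. This value shows that the second part adds nothing or just the next term of the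
  truncation in the first part.\<close>

lemma coeff_W_multiple_of_r:
  assumes "k < r * (k div r + 1)" "r * (k div r + 1) \<le> k + degree B"
  shows "coeff (W k) (r * (k div r + 1)) \<in> {0, coeff B (k div r + 1)}"
proof -
  define K where "K = k div r"
  define N where "N = r * (K + 1)"
  have N: "k < N" "1 \<le> N - k" "N - k \<le> degree B"
    using assms unfolding K_def N_def by linarith+
  from r_cong have "coeff (W k) N \<in> {0, coeff B (K + 1)}"
  proof
    assume r: "[int r = 1] (mod int (p * q))"
    have "[int N = int (K + 1)] (mod int (p * q))"
      using cong_scalar_right[OF r, of "int (K + 1)"] by (simp only: N_def of_nat_mult mult_1)
    hence "coeff (W k) N = - F (K + 1) (N - k) (int (K + 1))"
      using coeff_W_F_plus[OF N(1) r] unfolding K_def by (metis F_cong)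
    thus ?thesis
      using N by (subst (asm) F_diag) auto
  next
    assume r: "[int r = - 1] (mod int (p * q))"
    have W: "coeff (W k) N = F (degree B - K) (N - k) (int N + int (degree B))"
      using coeff_W_F_minus[OF N(1) r] by (simp add: K_def)
    show ?thesis
    proof (cases "K < degree B")
      case False
      thus ?thesis
        using W F_eq_0 by simp
    next
      case True
      have "[int N + int (degree B) = - int (K + 1) + int (degree B)] (mod int (p * q))"
        using cong_scalar_right[OF r, of "int (K + 1)"]
        by (intro cong_add cong_refl) (simp add: N_def algebra_simps)
      also have "- int (K + 1) + int (degree B) = int (degree B - K) - 1"
        using True by (simp add: of_nat_diff)
      finally have "coeff (W k) N = F (degree B - K) (N - k) (int (degree B - K) - 1)"
        using W by (metis F_cong)
      moreover have "coeff B (degree B - K - 1) = coeff B (K + 1)"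
        using coeff_B_reflect[of "K + 1"] True by simp
      ultimately show ?thesis
        using N True by (subst (asm) F_subdiag) auto
    qed
  qed
  thus ?thesis
    by (simp add: N_def K_def)
qed

lemma cmod_c_le: "cmod (c v) \<le> 1"
proof -
  have "c v = c (v mod int (p * q))"
    by (rule c_cong) (simp add: cong_def)
  also have "cmod \<dots> \<le> 1"
    using p_pos q_pos p_less_q by (subst c_nonneg) auto
  finally show ?thesis .
qed

text \<open>The window beyond \<open>k\<close> has \<open>degree B < r\<close> indices, so at most
  one of them is congruent to \<open>t\<close> modulo \<open>r\<close>. If \<open>r\<close> does not
  divide \<open>t\<close>, the value is at most one coefficient of \<open>W k\<close> times a value
  of \<open>c\<close>; otherwise it is a truncation of \<open>B\<close> applied to \<open>c\<close>,
  which is a value of \<open>F\<close> with second length 1.\<close>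

lemma flat_if_F:
  assumes F: "\<And>a a' n. cmod (F a a' n) \<le> 1"
  shows "cmod (coeff g n) \<le> 1"
proof -
  have part: "cmod (partial a c t) \<le> 1" for a t
    using F[of a 1 t] by (simp add: F_1 del: One_nat_def)
  have W: "cmod (coeff (W k) N) \<le> 1" if "k < N" for k N
    using r_cong coeff_W_F_plus[OF that] coeff_W_F_minus[OF that] F by (metis norm_minus_cancel)
  have "cmod (act (W k) c_dil t) \<le> 1" for k t
  proof (cases "\<exists>N\<in>{Suc k..k + degree B}. int r dvd t - int N")
    case False
    hence "act (W k) c_dil t = (if int r dvd t then partial (k div r + 1) c (t div int r) else 0)"
      by (simp add: act_W_eq c_dil_def)
    thus ?thesis
      using part by simp
  next
    case True
    then obtain N where N: "N \<in> {Suc k..k + degree B}" "int r dvd t - int N"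
      by blast
    have uniq: "N' = N" if "N' \<in> {Suc k..k + degree B}" "int r dvd t - int N'" for N'
    proof -
      have "int r dvd (t - int N') - (t - int N)"
        using that(2) N(2) by (rule dvd_diff)
      hence "int r dvd int N - int N'"
        by simp
      moreover have "\<bar>int N - int N'\<bar> < int r"
        using N(1) that(1) r_gt by auto
      ultimately show "N' = N"
        using dvd_imp_le_int[of "int N - int N'" "int r"] by fastforce
    qed
    have "(\<Sum>N'=Suc k..k + degree B. coeff (W k) N' * c_dil (t - int N')) =
        (\<Sum>N'\<in>{N}. coeff (W k) N' * c_dil (t - int N'))"
    proof (rule sum.mono_neutral_right)
      show "\<forall>N'\<in>{Suc k..k + degree B} - {N}. coeff (W k) N' * c_dil (t - int N') = 0"
      proof
        fix N' assume "N' \<in> {Suc k..k + degree B} - {N}"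
        hence "\<not> int r dvd t - int N'"
          using uniq by blast
        thus "coeff (W k) N' * c_dil (t - int N') = 0"
          by (simp add: c_dil_def)
      qed
    qed (use N(1) in auto)
    also have "\<dots> = coeff (W k) N * c ((t - int N) div int r)"
      using N by (simp add: c_dil_def)
    finally have X: "act (W k) c_dil t = (if int r dvd t then partial (k div r + 1) c (t div int r) else 0)
        + coeff (W k) N * c ((t - int N) div int r)"
      by (simp only: act_W_eq)
    show ?thesis
    proof (cases "int r dvd t")
      case False
      have "cmod (coeff (W k) N * c ((t - int N) div int r)) \<le> 1 * 1"
        unfolding norm_mult using N by (intro mult_mono W cmod_c_le) auto
      with False X show ?thesis
        by simp
    next
      case True
      then obtain w where w: "t = int r * w" by (elim dvdE)
      have "int r dvd t - (t - int N)"
        using True N(2) by (rule dvd_diff)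
      hence "r dvd N"
        by simp
      then obtain j where j: "N = r * j" ..
      define K where "K = k div r"
      have "r * K \<le> k" "k < r * (K + 1)"
        using r_pos by (auto simp: K_def dividend_less_times_div)
      have "K < j"
      proof (rule ccontr)
        assume "\<not> K < j"
        hence "r * j \<le> r * K"
          by simp
        moreover have "k < r * j"
          using N(1) j by simp
        ultimately show False
          using \<open>r * K \<le> k\<close> by linarith
      qed
      moreover have "j < K + 2"
      proof (rule ccontr)
        assume "\<not> j < K + 2"
        hence "r * (K + 2) \<le> r * j"
          by (intro mult_left_mono) auto
        moreover have "r * (K + 2) = r * (K + 1) + r"
          by simp
        ultimately have "k + r < N"
          using \<open>k < r * (K + 1)\<close> j by linarith
        thus False
          using N(1) r_gt by simp
      qed
      ultimately have j: "N = r * (K + 1)"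
        using j by (metis Suc_1 Suc_eq_plus1 add_Suc_right le_antisym less_Suc_eq_le Suc_leI)
      have "(t - int N) div int r = w - int (K + 1)"
        using r_pos by (simp add: w j flip: right_diff_distrib)
      hence X: "act (W k) c_dil t = partial (K + 1) c w + coeff (W k) N * c (w - int (K + 1))"
        using X w r_pos by (simp add: K_def)
      have "coeff (W k) N \<in> {0, coeff B (K + 1)}"
        using coeff_W_multiple_of_r[of k] N(1) j unfolding K_def by simp
      hence "act (W k) c_dil t = partial (K + 1) c w \<or> act (W k) c_dil t = partial (Suc (K + 1)) c w"
        using X by (auto simp: partial_Suc[of "Suc K"])
      thus ?thesis
        using part by metis
    qed
  qed
  thus ?thesis
    using flat_iff_W by blast
qed

text \<open>The two conditions on \<open>n\<close>, one for each sign of \<open>r\<close>, keep the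
  chosen index \<open>k + L\<close> from being a multiple of \<open>r\<close>. Then the sparse part
  of \<open>act_W_eq\<close> is absent, and the large coefficient of \<open>W k\<close> is isolated
  by \<open>c 0 = 1\<close>.\<close>

lemma not_flat_if_F:
  assumes a: "1 \<le> a" "a \<le> degree B" and big: "cmod (F a L n) > 1"
    and n: "\<not> int (p * q) dvd n - int a" "\<not> int (p * q) dvd n - int a + 1"
  shows "\<exists>n. cmod (coeff g n) > 1"
proof -
  have L: "1 \<le> L" "L \<le> degree B"
  proof -
    have "F a L n \<noteq> 0"
      using big by auto
    hence "\<not> (L = 0 \<or> L > degree B)"
      using F_eq_0 by blast
    thus "1 \<le> L" "L \<le> degree B"
      by simp_all
  qed
  \<comment> \<open>Since \<open>r\<close> is at least \<open>p q\<close>, the residue of the index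
    can be prescribed without changing \<open>k div r\<close>.\<close>
  have ex: "\<exists>e<r. [int (r * K + e + L) = m] (mod int (p * q))" for K m
  proof -
    define e where "e = nat ((m - int (r * K + L)) mod int (p * q))"
    have e: "int e = (m - int (r * K + L)) mod int (p * q)" "int e < int (p * q)"
      using p_pos q_pos by (simp_all add: e_def)
    have "int (r * K + e + L) = int (r * K + L) + int e"
      by simp
    hence "[int (r * K + e + L) = m] (mod int (p * q))"
      unfolding cong_def by (simp only: e(1) mod_add_right_eq) simp
    thus ?thesis
      using e(2) r_ge by (metis less_le_trans of_nat_less_iff)
  qed
  have "\<exists>k. cmod (coeff (W k) (k + L)) > 1 \<and> \<not> r dvd k + L"
  proof -
    have not_dvd: "\<not> r dvd r * K + e + L" if "e < r" "\<not> [int (r * K + e + L) = int r * int (K + 1)] (mod int (p * q))" for K e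
    proof
      assume "r dvd r * K + e + L"
      then obtain j where j: "r * K + e + L = r * j" ..
      have "r * K < r * j"
        using j L by linarith
      hence "K < j"
        by simp
      have "r * j < r * (K + 2)"
        using j L r_gt that by simp
      hence "j < K + 2"
        by (simp only: mult_less_cancel1)
      hence "j = K + 1"
        using \<open>K < j\<close> by simp
      thus False
        using that(2) by (simp only: j of_nat_mult cong_refl not_True_eq_False)
    qed
    from r_cong show ?thesis
    proof
      assume r: "[int r = 1] (mod int (p * q))"
      obtain e where e: "e < r" "[int (r * (a - 1) + e + L) = n] (mod int (p * q))"
        using ex by blast
      define k where "k = r * (a - 1) + e"
      have k: "k div r = a - 1"
        using e r_pos by (simp add: k_def)
      have "coeff (W k) (k + L) = - F a L (int (k + L))"
        using coeff_W_F_plus[OF _ r, of k "k + L"] L a by (simp add: k)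
      also have "F a L (int (k + L)) = F a L n"
        unfolding k_def by (rule F_cong[OF e(2)])
      finally have "cmod (coeff (W k) (k + L)) > 1"
        using big by simp
      moreover have "\<not> r dvd k + L"
        unfolding k_def
      proof (rule not_dvd[OF e(1)])
        have "[int r * int (a - 1 + 1) = int a] (mod int (p * q))"
          using cong_scalar_right[OF r, of "int a"] a by simp
        thus "\<not> [int (r * (a - 1) + e + L) = int r * int (a - 1 + 1)] (mod int (p * q))"
          using e(2) n(1) by (metis cong_iff_dvd_diff cong_sym cong_trans)
      qed
      ultimately show ?thesis
        by blast
    next
      assume r: "[int r = - 1] (mod int (p * q))"
      \<comment> \<open>Chosen so that the complementary length \<open>degree B - k div r\<close> in
        \<open>coeff_W_F_minus\<close> is \<open>a\<close>.\<close>
      define K where "K = degree B - a"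
      obtain e where e: "e < r" "[int (r * K + e + L) = n - int (degree B)] (mod int (p * q))"
        using ex by blast
      define k where "k = r * K + e"
      have k: "k div r = K"
        using e r_pos by (simp add: k_def)
      have "coeff (W k) (k + L) = F a L (int (k + L) + int (degree B))"
        using coeff_W_F_minus[OF _ r, of k "k + L"] L a by (simp add: k K_def)
      also have "\<dots> = F a L n"
        using cong_add[OF e(2) cong_refl[of "int (degree B)"]] unfolding k_def
        by (intro F_cong) simp
      finally have "cmod (coeff (W k) (k + L)) > 1"
        using big by simp
      moreover have "\<not> r dvd k + L"
        unfolding k_def
      proof (rule not_dvd[OF e(1)])
        have "- 1 * int (K + 1) = int a - 1 - int (degree B)"
          using a by (simp add: K_def of_nat_diff)
        hence "[int r * int (K + 1) = int a - 1 - int (degree B)] (mod int (p * q))"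
          using cong_scalar_right[OF r, of "int (K + 1)"] by (simp only:)
        thus "\<not> [int (r * K + e + L) = int r * int (K + 1)] (mod int (p * q))"
          using e(2) n(2) cong_iff_dvd_diff[of "n - int (degree B)" "int a - 1 - int (degree B)" "int (p * q)"]
          by (smt (verit) cong_sym cong_trans)
      qed
      ultimately show ?thesis
        by blast
    qed
  qed
  then obtain k where k: "cmod (coeff (W k) (k + L)) > 1" "\<not> r dvd k + L"
    by blast
  have "act (W k) c_dil (int (k + L)) =
      (\<Sum>N=Suc k..k + degree B. coeff (W k) N * c_dil (int (k + L) - int N))"
    using k(2) by (simp add: act_W_eq del: of_nat_add)
  also have "\<dots> = (\<Sum>N\<in>{k + L}. coeff (W k) N * c_dil (int (k + L) - int N))"
  proof (rule sum.mono_neutral_right)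
    show "\<forall>N\<in>{Suc k..k + degree B} - {k + L}. coeff (W k) N * c_dil (int (k + L) - int N) = 0"
    proof
      fix N assume N: "N \<in> {Suc k..k + degree B} - {k + L}"
      hence "int (k + L) - int N \<noteq> 0" "\<bar>int (k + L) - int N\<bar> < int r"
        using L r_gt by auto
      hence "\<not> int r dvd int (k + L) - int N"
        using dvd_imp_le_int[of "int (k + L) - int N" "int r"] by fastforce
      thus "coeff (W k) N * c_dil (int (k + L) - int N) = 0"
        by (simp add: c_dil_def)
    qed
  qed (use L in auto)
  also have "\<dots> = coeff (W k) (k + L)"
    using c_nonneg[of 0] p_pos q_pos by (simp add: c_dil_def)
  finally have "\<not> cmod (act (W k) c_dil (int (k + L))) \<le> 1"
    using k(1) by simp
  thus ?thesis
    using flat_iff_W by (meson not_le)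
qed

end

subsection \<open>A large value of \<open>F\<close> when \<open>q \<equiv> -1 (mod p)\<close> fails\<close>

context binary_cyclotomic
begin

definition b :: "int \<Rightarrow> complex" where "b = act B (\<lambda>k. of_bool (k = 0))"

lemma coeff_B_eq_b: "coeff B j = b (int j)"
  by (simp add: b_def act_impulse)

lemma b_neg: "v < 0 \<Longrightarrow> b v = 0"
  by (simp add: b_def act_impulse_neg)

text \<open>Compare coefficients in \<open>(1 - x^p) (1 - x^q) B = (1 - x) (1 - x^(p q))\<close>;
  below \<open>p + q\<close> the mixed term and the terms with \<open>x^(p q)\<close> sit at
  negative indices.\<close>

lemma b_rec:
  assumes "v < int (p + q)"
  shows "b v = of_bool (v = 0) - of_bool (v = 1) + b (v - int p) + b (v - int q)"
proof -
  let ?e = "\<lambda>k::int. of_bool (k = 0) :: complex"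
  have eq: "((1 - monom 1 p) * (1 - monom 1 q)) * B = (1 - monom 1 1) * (1 - monom 1 (p * q))"
    unfolding BC [symmetric] C_def geometric_poly [symmetric, of p] by (simp add: mult_ac)
  have "act ((1 - monom 1 p) * (1 - monom 1 q)) b v = act ((1 - monom 1 1) * (1 - monom 1 (p * q))) ?e v"
    unfolding b_def act_mult [symmetric] eq ..
  hence "b v - b (v - int q) - (b (v - int p) - b (v - int p - int q)) =
      ?e v - ?e (v - int (p * q)) - (?e (v - 1) - ?e (v - 1 - int (p * q)))"
    by (simp add: act_mult act_diff act_monom)
  moreover have "b (v - int p - int q) = 0"
    using assms by (intro b_neg) simp
  moreover have "v - int (p * q) < 0"
    using assms q_less_pq by linarith
  ultimately show ?thesis
    by (simp add: algebra_simps split: if_splits)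
qed

text \<open>In this range \<open>B\<close> agrees with the power series
  \<open>(1 - x) / (1 - x^p)\<close>.\<close>

lemma b_below_q:
  assumes "0 \<le> v" "v < int q"
  shows "b v = of_bool (int p dvd v) - of_bool (int p dvd v - 1)"
  using assms
proof (induction "nat v" arbitrary: v rule: less_induct)
  case less
  have rec: "b v = of_bool (v = 0) - of_bool (v = 1) + b (v - int p)"
    using less.prems p_pos by (subst b_rec) (auto simp: b_neg)
  show ?case
  proof (cases "v < int p")
    case True
    have "int p dvd v \<longleftrightarrow> v = 0"
      using True less.prems zdvd_not_zless[of v "int p"] by (cases "v = 0") auto
    moreover have "int p dvd v - 1 \<longleftrightarrow> v = 1"
    proof (cases "v \<le> 1")
      case True
      hence "v = 0 \<or> v = 1"
        using less.prems by linarith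
      thus ?thesis
        using p_ge_2 by auto
    next
      case False
      thus ?thesis
        using \<open>v < int p\<close> zdvd_not_zless[of "v - 1" "int p"] by auto
    qed
    ultimately show ?thesis
      using rec True by (simp add: b_neg)
  next
    case False
    have "b (v - int p) = of_bool (int p dvd v - int p) - of_bool (int p dvd v - int p - 1)"
      using False less.prems p_pos by (intro less.hyps) auto
    moreover have "int p dvd v - int p \<longleftrightarrow> int p dvd v" "int p dvd (v - 1) - int p \<longleftrightarrow> int p dvd v - 1"
      by (simp_all add: dvd_diff_left_iff)
    moreover have "v - int p - 1 = (v - 1) - int p"
      by simp
    ultimately show ?thesis
      using rec False p_ge_2 by simp
  qed
qed

lemma partial_block:
  assumes "k * p + p < q"
  shows "partial (k * p + p + 1) u n = partial (k * p + 1) u n - u (n - int (k * p + 1)) + u (n - int (k * p + p))"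
proof -
  have coeff: "coeff B j = of_bool (j = k * p + p) - of_bool (j = k * p + 1)"
    if "j \<in> {k * p + 1..<k * p + p + 1}" for j
  proof -
    define i where "i = j - k * p"
    have i: "j = k * p + i" "1 \<le> i" "i \<le> p"
      using that by (auto simp: i_def)
    have "int p dvd int j \<longleftrightarrow> p dvd i" and "int p dvd int j - 1 \<longleftrightarrow> p dvd i - 1"
    proof -
      have "int p dvd int j \<longleftrightarrow> p dvd k * p + i"
        using i by simp
      thus "int p dvd int j \<longleftrightarrow> p dvd i"
        by (simp add: dvd_add_right_iff)
      have "int j - 1 = int (k * p + (i - 1))"
        using i by (simp add: of_nat_diff)
      thus "int p dvd int j - 1 \<longleftrightarrow> p dvd i - 1"
        by (simp only: of_nat_dvd_iff) (simp add: dvd_add_right_iff)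
    qed
    moreover have "p dvd i \<longleftrightarrow> i = p"
      using i by (auto dest: dvd_imp_le)
    moreover have "p dvd i - 1 \<longleftrightarrow> i = 1"
      using i p_ge_2 by (auto dest: dvd_imp_le)
    ultimately show ?thesis
      using i that assms by (simp add: coeff_B_eq_b b_below_q del: of_nat_add of_nat_mult)
  qed
  have "partial (k * p + p + 1) u n = partial (k * p + 1) u n +
      (\<Sum>j\<in>{k * p + 1..<k * p + p + 1}. coeff B j * u (n - int j))"
    unfolding partial_def lessThan_atLeast0
    by (subst sum.atLeastLessThan_concat) auto
  also have "(\<Sum>j\<in>{k * p + 1..<k * p + p + 1}. coeff B j * u (n - int j)) =
      (\<Sum>j\<in>{k * p + 1..<k * p + p + 1}.
        (if j = k * p + p then u (n - int j) else 0) - (if j = k * p + 1 then u (n - int j) else 0))"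
    by (rule sum.cong [OF refl]) (auto simp: coeff)
  also have "\<dots> = u (n - int (k * p + p)) - u (n - int (k * p + 1))"
    using p_ge_2 by (simp add: sum_subtractf)
  finally show ?thesis
    by simp
qed

lemma partial_first_block: "partial (p + 1) u n = u n - u (n - 1) + u (n - int p)"
  using partial_block[of 0 u n] p_less_q by simp

text \<open>Every block of length \<open>p\<close> adds two values of \<open>c\<close> with opposite
  signs; written as differences of boxes at distance \<open>p\<close>, they move the two trailing
  boxes by \<open>p\<close>.\<close>

lemma partial_blocks_c:
  assumes "k * p < q"
  shows "partial (k * p + 1) c n = delta (p * q) n - delta (p * q) (n - int q) +
    box (n - int (k * p) - 1) - box (n - int (k * p) - int p)"
  using assms
proof (induction k)
  case 0
  thus ?case
    using box_telescope[of n] by (simp add: c_alt algebra_simps)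
next
  case (Suc k)
  have "partial (Suc k * p + 1) c n = partial (k * p + 1) c n - c (n - int (k * p + 1)) + c (n - int (k * p + p))"
    using partial_block[of k c n] Suc.prems by (simp add: add.commute)
  also have "partial (k * p + 1) c n = delta (p * q) n - delta (p * q) (n - int q) +
      box (n - int (k * p) - 1) - box (n - int (k * p) - int p)"
    using Suc by simp
  finally show ?case
    unfolding c_alt by (simp add: algebra_simps)
qed

section \<open>Indices at which F equals 2\<close>

lemma box_neg: "- int p < v \<Longrightarrow> v < 0 \<Longrightarrow> box v = 0"
proof -
  assume v: "- int p < v" "v < 0"
  have "box v = box (v + int (p * q))"
    by (rule box_cong) (simp add: cong_iff_dvd_diff)
  also have "int q \<le> v + int (p * q)"
    using v q_less_pq by linarith
  hence "box (v + int (p * q)) = 0"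
    using v by (subst box_small) auto
  finally show ?thesis .
qed

lemma delta_small: "\<bar>v\<bar> < int (p * q) \<Longrightarrow> delta (p * q) v = of_bool (v = 0)"
  unfolding delta_def using dvd_imp_le_int[of v "int (p * q)"] by fastforce

text \<open>Here \<open>m + 1\<close> is the quotient of \<open>q\<close> by \<open>p\<close>, and
  the strict bound excludes remainder \<open>p - 1\<close>. The value is
  \<open>0 - (-1) + 1\<close>; with remainder \<open>p - 1\<close> both boxes would be 1 at the
  third argument and its contribution would vanish.\<close>

lemma F_large_quotient:
  assumes m: "m \<ge> 1" "m * p + p \<le> q" "q + 1 < m * p + 2 * p"
  shows "F (p + 1) (m * p + 1) (int q + 1) = 2"
proof -
  have bnd: "int p + int q \<le> int (p * q)" "int p \<ge> 2"
    using q_less_pq p_ge_2 by linarith+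
  define M where "M = int (m * p)"
  have "1 * p \<le> m * p"
    using m by (intro mult_right_mono) auto
  hence M: "M \<ge> int p" "M + int p \<le> int q" "int q + 1 < M + 2 * int p"
    using m unfolding M_def by linarith+
  have G: "partial (m * p + 1) c v = delta (p * q) v - delta (p * q) (v - int q) +
      box (v - M - 1) - box (v - M - int p)" for v
    using partial_blocks_c[of m v] m p_pos by (simp add: M_def)
  have G1: "partial (m * p + 1) c (int q + 1) = 0"
    unfolding G using M bnd by (simp add: delta_small box_small)
  have G2: "partial (m * p + 1) c (int q) = -1"
    unfolding G using M bnd by (simp add: delta_small box_small)
  have G3: "partial (m * p + 1) c (int q + 1 - int p) = 1"
    unfolding G using M bnd by (simp add: delta_small box_small box_neg)
  show ?thesis
    unfolding F_def partial_first_block using G1 G2 G3 by simp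
qed

text \<open>For quotient 1 there are too few blocks below \<open>q\<close>, so the coefficients up
  to \<open>2 p\<close> are listed by unrolling \<open>b_rec\<close>.\<close>

lemma b_below_2p:
  assumes "q < 2 * p - 1" "p + 2 \<le> q" "j \<le> 2 * p"
  shows "coeff B j = of_bool (j = 0) - of_bool (j = 1) + of_bool (j = p) - of_bool (j = p + 1)
    + of_bool (j = q) - of_bool (j = q + 1) + of_bool (j = 2 * p)"
proof -
  have "b v = of_bool (v = 0) - of_bool (v = 1)" if "v < int p" for v
    using that p_less_q by (subst b_rec) (auto simp: b_neg)
  moreover have "b (int j - int p) = of_bool (j = p) - of_bool (j = p + 1) + b (int j - int p - int p)"
    using assms by (subst b_rec) (auto simp: b_neg)
  moreover have "b (int j) = of_bool (j = 0) - of_bool (j = 1) + b (int j - int p) + b (int j - int q)"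
    using assms by (subst b_rec) auto
  ultimately show ?thesis
    using assms by (auto simp: coeff_B_eq_b)
qed

lemma sum_of_bool_mult:
  "(\<Sum>j<a. of_bool (j = k) * u (int j)) = (of_bool (k < a) * u (int k) :: complex)"
proof -
  have "(\<Sum>j<a. of_bool (j = k) * u (int j)) = (\<Sum>j<a. if j = k then u (int j) else 0)"
    by (rule sum.cong) auto
  thus ?thesis
    by simp
qed

lemma partial_below_2p:
  assumes "q < 2 * p - 1" "p + 2 \<le> q" "a \<le> 2 * p + 1"
  shows "partial a u n = of_bool (0 < a) * u n - of_bool (1 < a) * u (n - 1)
    + of_bool (p < a) * u (n - int p) - of_bool (p + 1 < a) * u (n - int p - 1)
    + of_bool (q < a) * u (n - int q) - of_bool (q + 1 < a) * u (n - int q - 1)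
    + of_bool (2 * p < a) * u (n - 2 * int p)"
proof -
  have "partial a u n = (\<Sum>j<a. (of_bool (j = 0) - of_bool (j = 1) + of_bool (j = p) - of_bool (j = p + 1)
    + of_bool (j = q) - of_bool (j = q + 1) + of_bool (j = 2 * p)) * u (n - int j))"
    unfolding partial_def using assms by (intro sum.cong refl arg_cong2[of _ _ _ _ "(*)"] b_below_2p) auto
  thus ?thesis
    by (simp only: distrib_right left_diff_distrib sum.distrib sum_subtractf
        sum_of_bool_mult[of _ "\<lambda>j. u (n - j)"]) (simp add: algebra_simps)
qed

text \<open>For quotient 1 the order of \<open>3 p\<close> and \<open>2 q\<close> decides which
  shifted arguments hit the two runs of \<open>c\<close>, so each order has its own witness.\<close>

lemma F_quotient_1_large:
  assumes "p \<ge> 3" "q < 2 * p - 1" "p + 2 \<le> q" "3 * p < 2 * q"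
  shows "F (p + 1) (2 * p + 1) (2 * int q + 1) = 2"
proof -
  have "3 * q \<le> p * q"
    using assms by simp
  hence c: "c v = of_bool (v < int p) - of_bool (int q \<le> v \<and> v < int q + int p)"
    if "0 \<le> v" "v < 3 * int q" for v
    using that by (intro c_nonneg) linarith+
  have *: "int p \<ge> 3" "int q + 1 < 2 * int p" "int p + 2 \<le> int q" "3 * int p < 2 * int q"
    using assms by linarith+
  have "\<not> q < p" "\<not> q + 1 < p + 1" "q < 2 * p" "q + 1 < 2 * p + 1"
    using assms by linarith+
  thus ?thesis
    unfolding F_def using assms * by (simp add: partial_below_2p c algebra_simps)
qed

lemma F_quotient_1_small:
  assumes "p \<ge> 3" "p + 2 \<le> q" "2 * q < 3 * p"
  shows "F (q + 1) (q + 1) (3 * int p + 1) = 2"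
proof -
  have "3 * q \<le> p * q"
    using assms by simp
  hence c: "c v = of_bool (v < int p) - of_bool (int q \<le> v \<and> v < int q + int p)"
    if "0 \<le> v" "v < 3 * int q" for v
    using that by (intro c_nonneg) linarith+
  have *: "int p \<ge> 3" "int p + 2 \<le> int q" "2 * int q < 3 * int p"
    using assms by linarith+
  have "q < 2 * p - 1" "q + 1 \<le> 2 * p + 1" "\<not> 2 * p < q + 1"
    using assms by linarith+
  thus ?thesis
    unfolding F_def using assms * by (simp add: partial_below_2p c algebra_simps)
qed

lemma exists_large_F:
  assumes p: "p \<ge> 3" and q: "p + 2 \<le> q" and ndvd: "\<not> p dvd q + 1"
  shows "\<exists>a L n. 1 \<le> a \<and> a \<le> degree B \<and> cmod (F a L n) > 1 \<and>
    \<not> int (p * q) dvd n - int a \<and> \<not> int (p * q) dvd n - int a + 1"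
proof -
  have "3 * q \<le> p * q"
    using p by simp
  hence deg: "2 * q \<le> degree B + p" "3 * q \<le> p * q"
    using degree_B by linarith+
  \<comment> \<open>The differences \<open>n - a\<close> and \<open>n - a + 1\<close> of all three
    witnesses lie strictly between 0 and \<open>3 q\<close>, which is at most
    \<open>p q\<close>.\<close>
  have ndvd': "\<not> int (p * q) dvd v" if "0 < v" "v < int (3 * q)" for v
    using that deg zdvd_not_zless[of v "int (p * q)"] by linarith
  show ?thesis
  proof (cases "2 * p \<le> q")
    case True
    define m where "m = q div p - 1"
    have "2 \<le> q div p"
      using True p by (simp add: less_eq_div_iff_mult_less_eq)
    hence m: "m \<ge> 1" "m * p + p = q div p * p"
      by (simp_all add: m_def diff_mult_distrib)
    have "m * p + p \<le> q"
      by (simp add: m)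
    moreover have "q + 1 < m * p + 2 * p"
    proof -
      have "q mod p + 1 \<noteq> p"
      proof
        assume "q mod p + 1 = p"
        hence "q + 1 = q div p * p + p"
          using div_mult_mod_eq[of q p] by linarith
        thus False
          using ndvd by simp
      qed
      moreover have "q mod p < p"
        using p by simp
      ultimately show ?thesis
        using m div_mult_mod_eq[of q p] by linarith
    qed
    ultimately have "F (p + 1) (m * p + 1) (int q + 1) = 2"
      using m by (intro F_large_quotient) auto
    moreover have "\<not> int (p * q) dvd int q + 1 - int (p + 1)" "\<not> int (p * q) dvd int q + 1 - int (p + 1) + 1"
      by (rule ndvd'; use q in simp)+
    ultimately show ?thesis
      using deg q by (intro exI[of _ "p + 1"] exI[of _ "m * p + 1"] exI[of _ "int q + 1"]) auto
  next
    case False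
    have "q + 1 \<noteq> 2 * p"
      using ndvd by (metis dvd_triv_right)
    hence q2: "q < 2 * p - 1"
      using False by linarith
    have "3 * p \<noteq> 2 * q"
    proof
      assume "3 * p = 2 * q"
      hence "p dvd 2 * q"
        by (metis dvd_triv_right)
      hence "p dvd 2"
        using coprime_pq by (simp add: coprime_dvd_mult_left_iff)
      thus False
        using p by (auto dest: dvd_imp_le)
    qed
    then consider "3 * p < 2 * q" | "2 * q < 3 * p"
      by linarith
    thus ?thesis
    proof cases
      case 1
      have "F (p + 1) (2 * p + 1) (2 * int q + 1) = 2"
        using p q q2 1 by (intro F_quotient_1_large) auto
      moreover have "\<not> int (p * q) dvd 2 * int q + 1 - int (p + 1)"
        "\<not> int (p * q) dvd 2 * int q + 1 - int (p + 1) + 1"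
        by (rule ndvd'; use q in simp)+
      ultimately show ?thesis
        using deg q by (intro exI[of _ "p + 1"] exI[of _ "2 * p + 1"] exI[of _ "2 * int q + 1"]) auto
    next
      case 2
      have "F (q + 1) (q + 1) (3 * int p + 1) = 2"
        using p q 2 by (intro F_quotient_1_small) auto
      moreover have "\<not> int (p * q) dvd 3 * int p + 1 - int (q + 1)"
        "\<not> int (p * q) dvd 3 * int p + 1 - int (q + 1) + 1"
        by (rule ndvd'; use q False p_less_q in simp)+
      ultimately show ?thesis
        using deg q by (intro exI[of _ "q + 1"] exI[of _ "q + 1"] exI[of _ "3 * int p + 1"]) auto
    qed
  qed
qed

end

subsection \<open>The case \<open>q \<equiv> -1 (mod p)\<close>\<close>

text \<open>To be read with \<open>y = x^q\<close> and \<open>z = x^p\<close>, where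
  \<open>l p = q + 1\<close> gives \<open>z^l = x y\<close>. In the induction only the end of a row
  needs care: there \<open>z^l\<close> is replaced by \<open>x y\<close>, which starts the next
  row.\<close>

lemma staircase_sum:
  fixes x y z :: "'a::comm_ring_1"
  assumes z: "z ^ l = x * y" and l: "l > 0"
  shows "(1 - z) * (1 - y) * (\<Sum>m<M. y ^ (m div l) * z ^ (m mod l) - x * z ^ m) =
    (1 - x) * (1 - y ^ (M div l + 1)) - y ^ (M div l) * z ^ (M mod l) * (1 - y) * (1 - x ^ (M div l + 1))"
proof (induction M)
  case 0
  show ?case
    by (simp add: mult_ac)
next
  case (Suc M)
  define d e where "d = M div l" and "e = M mod l"
  have "z ^ M = z ^ (l * d + e)"
    by (simp add: d_def e_def)
  hence zM: "z ^ M = x ^ d * y ^ d * z ^ e"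
    by (simp add: power_add power_mult z power_mult_distrib)
  have IH: "(1 - z) * (1 - y) * (\<Sum>m<M. y ^ (m div l) * z ^ (m mod l) - x * z ^ m) =
      (1 - x) * (1 - y * y ^ d) - y ^ d * z ^ e * (1 - y) * (1 - x * x ^ d)"
    using Suc by (simp add: d_def e_def)
  have sum: "(1 - z) * (1 - y) * (\<Sum>m<Suc M. y ^ (m div l) * z ^ (m mod l) - x * z ^ m) =
      (1 - x) * (1 - y * y ^ d) - y ^ d * (z * z ^ e) * (1 - y) * (1 - x * x ^ d)"
    unfolding sum.lessThan_Suc distrib_left IH d_def [symmetric] e_def [symmetric] zM
    by (simp add: algebra_simps)
  show ?case
  proof (cases "Suc e = l")
    case True
    hence "Suc M div l = Suc d" "Suc M mod l = 0"
      using l by (auto simp: d_def e_def mod_Suc div_Suc)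
    moreover have "z * z ^ e = x * y"
      using z True by (metis power_Suc)
    ultimately show ?thesis
      unfolding sum by (simp add: algebra_simps)
  next
    case False
    hence "Suc M div l = d" "Suc M mod l = Suc e"
      by (auto simp: d_def e_def mod_Suc div_Suc)
    thus ?thesis
      unfolding sum by simp
  qed
qed

section \<open>The staircase form of B and of its truncations\<close>

locale binary_cyclotomic_flat = binary_cyclotomic +
  fixes l :: nat
  assumes l: "q + 1 = l * p"
begin

text \<open>Positive terms are numbered row by row, \<open>l\<close> to a row. By
  \<open>pos_eq\<close> each completed row lowers the exponent by 1 compared with
  \<open>m p\<close>.\<close>

definition pos :: "nat \<Rightarrow> nat" where "pos m = (m div l) * q + (m mod l) * p"

text \<open>The flag \<open>w\<close> records whether the last term is positive; it is also the
  value of the polynomial at 1.\<close>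

definition prefix :: "bool \<Rightarrow> nat \<Rightarrow> complex poly" where
  "prefix w M = (\<Sum>m<M. monom 1 (pos m) - monom 1 (m * p + 1)) + (if w then monom 1 (pos M) else 0)"

lemma l_pos: "l > 0"
  using l by (cases "l = 0") auto

lemma pos_eq: "pos m + m div l = m * p"
proof -
  have "pos m + m div l = (m div l) * (q + 1) + (m mod l) * p"
    by (simp add: pos_def)
  also have "\<dots> = (m div l * l + m mod l) * p"
    by (simp only: l distrib_right mult.assoc)
  finally show ?thesis
    by (simp only: div_mult_mod_eq)
qed

lemma staircase_sum_poly:
  "(1 - monom 1 p) * (1 - monom 1 q) * (\<Sum>m<M. monom 1 (pos m) - monom 1 (m * p + 1)) =
    (1 - monom 1 1) * (1 - monom 1 ((M div l + 1) * q)) -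
    monom 1 (pos M) * (1 - monom 1 q) * (1 - monom 1 (M div l + 1) :: complex poly)"
proof -
  have eq: "(monom 1 p :: complex poly) ^ l = monom 1 1 * monom 1 q"
    using l by (simp add: monom_power mult_monom mult.commute)
  show ?thesis
    using staircase_sum[OF eq l_pos, of M]
    by (simp add: monom_power mult_monom pos_def mult_ac add_ac del: One_nat_def mult_Suc_right)
qed

text \<open>Multiplication by \<open>1 - x\<close> turns \<open>C\<close> into
  \<open>(1 - x^p) (1 - x^q)\<close>, to which the staircase identity applies. The number of terms
  on the right does not grow with \<open>M\<close>, which is why \<open>F\<close> becomes a sum of
  four values.\<close>

lemma prefix_times_C:
  "prefix w M * C = 1 - monom 1 ((M div l + 1) * q) -
    monom 1 (pos M) * (\<Sum>i<q. monom 1 i) * ((if w then monom 1 p else 1) - monom 1 (M div l + 1))"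
proof -
  let ?S = "\<Sum>m<M. monom 1 (pos m) - monom 1 (m * p + 1) :: complex poly"
  let ?g = "\<Sum>i<q. monom 1 i :: complex poly"
  have C1: "(1 - monom 1 1) * C = (1 - monom 1 p) * (1 - monom 1 q)"
    unfolding C_def geometric_poly [symmetric, of p] by (simp add: mult_ac)
  have "(1 - monom 1 1) * (prefix w M * C) = ((1 - monom 1 1) * C) * prefix w M"
    by (simp only: mult_ac)
  also have "\<dots> = (1 - monom 1 p) * (1 - monom 1 q) * ?S +
      (1 - monom 1 p) * (1 - monom 1 q) * (if w then monom 1 (pos M) else 0)"
    by (simp only: C1 prefix_def distrib_left)
  also have "\<dots> = (1 - monom 1 1) * (1 - monom 1 ((M div l + 1) * q)) -
      monom 1 (pos M) * (1 - monom 1 q) * ((if w then monom 1 p else 1) - monom 1 (M div l + 1))"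
    unfolding staircase_sum_poly by (simp add: algebra_simps)
  also have "\<dots> = (1 - monom 1 1) * (1 - monom 1 ((M div l + 1) * q) -
      monom 1 (pos M) * ?g * ((if w then monom 1 p else 1) - monom 1 (M div l + 1)))"
    unfolding geometric_poly [symmetric, of q]
    by (simp only: right_diff_distrib[of "1 - monom 1 1" "1 - _" "_ * _"] mult_ac)
  finally show ?thesis
    using one_minus_monom_nonzero[of 1, where ?'a = complex] by (metis mult_left_cancel zero_less_one)
qed

text \<open>The rectangle has \<open>l (p - 1)\<close> positive terms, and there is one negative
  term fewer. Both sides have the same product with the nonzero \<open>C\<close>.\<close>

lemma B_eq_prefix: "B = prefix True (l * (p - 1) - 1)"
proof -
  define M where "M = l * (p - 1) - 1"
  have "l * (p - 1) \<ge> l * 1"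
    using p_ge_2 by (intro mult_left_mono) auto
  hence M: "M + 1 = l * (p - 1)"
    using l_pos by (simp add: M_def)
  have "M = l * (p - 2) + (l - 1)"
  proof -
    have "l * (p - 1) = l * (p - 2) + l"
      using p_ge_2 by (metis Suc_1 Suc_diff_le diff_Suc_Suc diff_Suc_1 mult_Suc_right add.commute)
    thus ?thesis
      using M l_pos by simp
  qed
  moreover have "l - 1 < l"
    using l_pos by simp
  ultimately have dm: "M div l = p - 2" "M mod l = l - 1"
    by (metis add.commute div_less div_mult_self2 add_0 less_nat_zero_code l_pos less_numeral_extra(3),
        metis mod_less mod_mult_self4)
  have pM: "pos M + p = (p - 1) * q + 1" "pos M + (p - 1) = (p - 1) * q"
  proof -
    have "pos M + p = (p - 2) * q + l * p"
      using l_pos by (simp add: pos_def dm mult_eq_if)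
    also have "\<dots> = ((p - 2) * q + q) + 1"
      using l by simp
    also have "(p - 2) * q + q = (p - 1) * q"
      using p_ge_2 by (metis Suc_1 Suc_diff_le add.commute diff_Suc_1 diff_Suc_Suc mult_Suc)
    finally show "pos M + p = (p - 1) * q + 1" .
    thus "pos M + (p - 1) = (p - 1) * q"
      using p_ge_2 by linarith
  qed
  have p2: "p - 2 + 1 = p - 1"
    using p_ge_2 by simp
  have pq: "(p - 1) * q + q = p * q"
    using p_pos by (metis Suc_diff_1 add.commute mult_Suc)
  let ?g = "\<Sum>i<q. monom 1 i :: complex poly"
  have "prefix True M * C = 1 - monom 1 ((p - 1) * q) -
      (monom 1 (pos M + p) - monom 1 (pos M + (p - 1))) * ?g"
    unfolding prefix_times_C dm p2 by (simp add: mult_monom right_diff_distrib mult_ac add_ac)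
  also have "\<dots> = 1 - monom 1 ((p - 1) * q) + monom 1 ((p - 1) * q) * ((1 - monom 1 1) * ?g)"
    unfolding pM by (simp add: mult_monom algebra_simps)
  also have "\<dots> = 1 - monom 1 (p * q)"
    unfolding geometric_poly right_diff_distrib mult_monom pq by simp
  finally have "prefix True M * C = B * C"
    by (simp add: BC)
  thus ?thesis
    using C_nonzero by (simp add: M_def)
qed

text \<open>
  The exponents \<open>pos m\<close> of the positive terms of \<open>B\<close> and those of its negative terms alternate,
  so that every initial segment of \<open>B\<close> is one of the polynomials \<open>prefix w M\<close>.
\<close>

lemma partial_eq_prefix:
  obtains w M where "M < l * (p - 1)" "\<And>u n. partial a u n = act (prefix w M) u n"
proof -
  define N where "N = l * (p - 1)"
  define e where "e i = (if even i then pos (i div 2) else i div 2 * p + 1)" for i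
  define T where "T u n I = (\<Sum>i<I. (-1) ^ i * u (n - int (e i)))" for u :: "int \<Rightarrow> complex" and n I
  have N: "N > 0"
    using l_pos p_ge_2 by (simp add: N_def)
  have even: "T u n (2 * M) = act (prefix False M) u n" for u n M
    by (induction M) (auto simp: T_def prefix_def e_def act_add act_sum act_diff act_monom)
  have odd: "T u n (Suc (2 * M)) = act (prefix True M) u n" for u n M
    using even[of u n M] by (simp add: T_def prefix_def e_def act_add act_monom)
  have step: "e i \<le> e (Suc i)" if "Suc i < 2 * N" for i
  proof (cases "even i")
    case True
    thus ?thesis
      using pos_eq[of "i div 2"] by (simp add: e_def)
  next
    case False
    then obtain m where m: "i = 2 * m + 1"
      by (elim oddE)
    \<comment> \<open>Only \<open>p - 1\<close> rows are used, so \<open>pos (m + 1)\<close> is less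
      than \<open>(m + 1) p\<close> by at most \<open>p - 2\<close> and stays above
      \<open>m p + 1\<close>.\<close>
    have "m + 1 < l * (p - 1)"
      using that by (simp add: m N_def)
    hence "(m + 1) div l < p - 1"
      using l_pos by (simp add: div_less_iff_less_mult mult.commute)
    moreover have "(m + 1) * p = m * p + p"
      by simp
    ultimately have "m * p + 1 \<le> pos (m + 1)"
      using pos_eq[of "m + 1"] by linarith
    thus ?thesis
      by (simp add: e_def m)
  qed
  have mono: "e i \<le> e j" if "i \<le> j" "j < 2 * N" for i j
    using that by (induction j rule: dec_induct) (auto intro: order_trans step)
  define A where "A = {i. i < 2 * N - 1 \<and> e i < a}"
  have fin: "finite A"
    by (simp add: A_def)
  have "A = {..<card A}"
  proof -
    have "\<exists>I. A = {..<I}"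
    proof (cases "A = {}")
      case False
      have "A = {..<Suc (Max A)}"
      proof (intro equalityI subsetI)
        fix i assume "i \<in> A"
        thus "i \<in> {..<Suc (Max A)}"
          using fin by (simp add: less_Suc_eq_le)
      next
        fix i assume i: "i \<in> {..<Suc (Max A)}"
        have "Max A \<in> A"
          using fin False by (rule Max_in)
        hence "e i \<le> e (Max A)" "e (Max A) < a" "Max A < 2 * N - 1"
          using i by (auto simp: A_def intro!: mono)
        thus "i \<in> A"
          using i by (simp add: A_def)
      qed
      thus ?thesis ..
    qed auto
    thus ?thesis
      by force
  qed
  then obtain I where I: "A = {..<I}"
    by blast
  have IN: "I \<le> 2 * N - 1"
  proof -
    have "{..<I} \<subseteq> {..<2 * N - 1}"
      unfolding I [symmetric] by (auto simp: A_def)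
    thus ?thesis
      by (simp only: lessThan_subset_iff)
  qed
  have B: "coeff B j = (\<Sum>i<2 * N - 1. if e i = j then (-1) ^ i else 0)" for j
  proof -
    have "2 * N - 1 = Suc (2 * (N - 1))"
      using N by simp
    moreover have "coeff B j = act B (\<lambda>k. of_bool (k = 0)) (int j)"
      by (simp add: act_impulse)
    ultimately have "coeff B j = T (\<lambda>k. of_bool (k = 0)) (int j) (2 * N - 1)"
      using odd[of "\<lambda>k. of_bool (k = 0)" "int j" "N - 1"] B_eq_prefix by (simp add: N_def)
    also have "\<dots> = (\<Sum>i<2 * N - 1. if e i = j then (-1) ^ i else 0)"
      unfolding T_def by (rule sum.cong) auto
    finally show ?thesis .
  qed
  have partial: "partial a u n = T u n I" for u n
  proof -
    have "partial a u n = (\<Sum>j<a. \<Sum>i<2 * N - 1. if e i = j then (-1) ^ i * u (n - int j) else 0)"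
      unfolding partial_def B sum_distrib_right by (intro sum.cong refl) auto
    also have "\<dots> = (\<Sum>i<2 * N - 1. \<Sum>j<a. if e i = j then (-1) ^ i * u (n - int j) else 0)"
      by (rule sum.swap)
    also have "\<dots> = (\<Sum>i<2 * N - 1. if e i < a then (-1) ^ i * u (n - int (e i)) else 0)"
      by simp
    also have "\<dots> = (\<Sum>i\<in>A. (-1) ^ i * u (n - int (e i)))"
      unfolding A_def by (rule sum.mono_neutral_cong_right) auto
    finally show ?thesis
      by (simp add: T_def I)
  qed
  show ?thesis
  proof (cases "even I")
    case True
    then obtain M where M: "I = 2 * M" by (elim evenE)
    hence "M < N"
      using IN N by linarith
    thus ?thesis
      using that[of M False] partial even by (simp add: N_def M)
  next
    case False
    then obtain M where M: "I = 2 * M + 1" by (elim oddE)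
    hence "M < N"
      using IN N by linarith
    thus ?thesis
      using that[of M True] partial odd by (simp add: N_def M)
  qed
qed

end

section \<open>Truncations modulo x^(pq) - 1 in Chinese remainder coordinates\<close>

context binary_cyclotomic_flat
begin

lemma act_prefix_True:
  "act (prefix True M) u n = u (n - int (pos M)) + (\<Sum>m<M. u (n - int (pos m)) - u (n - int (m * p + 1)))"
  by (simp add: prefix_def act_add act_sum act_diff act_monom)

text \<open>For \<open>u < q\<close> the residue of \<open>u p\<close> modulo \<open>q\<close> is
  \<open>u p - (u div l) q\<close>, which equals \<open>(u mod l) p + u div l\<close>. The exponents
  of the box are thus renumbered by their column \<open>u\<close>.\<close>

lemma box_reindex: "(\<Sum>u<q. delta (p * q) (n - int (u * p) + int (u div l * q))) = box n"
  unfolding box_sum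
proof (rule sum.reindex_bij_witness[of _ "\<lambda>v. (v mod p) * l + v div p" "\<lambda>u. (u mod l) * p + u div l"])
  fix u assume u: "u \<in> {..<q}"
  hence "u + 1 < p * l"
    using l by (simp add: mult.commute)
  hence d: "u div l < p"
    using l_pos by (simp add: div_less_iff_less_mult mult.commute)
  have m: "u mod l < l"
    using l_pos by simp
  have eq: "u * p = u div l * q + ((u mod l) * p + u div l)"
  proof -
    have "u * p = (u div l * l + u mod l) * p"
      by (simp only: div_mult_mod_eq)
    also have "\<dots> = u div l * (l * p) + u mod l * p"
      by (simp only: distrib_right mult.assoc)
    finally show ?thesis
      by (simp add: l [symmetric])
  qed
  show "(u mod l * p + u div l) mod p * l + (u mod l * p + u div l) div p = u"
    using d p_pos by simp
  show "u mod l * p + u div l \<in> {..<q}"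
  proof -
    have "u mod l * p + u div l < q"
    proof (rule ccontr)
      assume "\<not> u mod l * p + u div l < q"
      moreover have "u mod l * p + p \<le> l * p"
      proof -
        have "(u mod l + 1) * p \<le> l * p"
          using m by (intro mult_right_mono) auto
        thus ?thesis
          by simp
      qed
      ultimately have "u div l = p - 1" "u mod l * p + p = l * p"
        using d l by linarith+
      hence "u mod l + 1 = l"
        using p_pos by (metis mult_right_cancel neq0_conv add_mult_distrib mult_1)
      hence "u + 1 = (p - 1) * l + l"
        using \<open>u div l = p - 1\<close> by (metis add.assoc div_mult_mod_eq)
      hence "u + 1 = p * l"
        using p_pos by (metis Suc_diff_1 add.commute mult_Suc)
      thus False
        using \<open>u + 1 < p * l\<close> by simp
    qed
    thus ?thesis
      by simp
  qed
  show "delta (p * q) (n - int (u mod l * p + u div l)) =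
      (delta (p * q) (n - int (u * p) + int (u div l * q)) :: complex)"
    unfolding eq by (simp add: algebra_simps)
next
  fix v assume v: "v \<in> {..<q}"
  hence "v + 1 < l * p"
    using l by simp
  hence d: "v div p < l"
    using p_pos by (simp add: div_less_iff_less_mult)
  have m: "v mod p < p"
    using p_pos by simp
  show "(v mod p * l + v div p) mod l * p + (v mod p * l + v div p) div l = v"
    using d l_pos by simp
  have "(v mod p + 1) * l \<le> p * l"
    using m by (intro mult_right_mono) auto
  hence le: "v mod p * l + l \<le> p * l"
    by simp
  show "v mod p * l + v div p \<in> {..<q}"
  proof -
    have "v mod p * l + v div p < q"
    proof (rule ccontr)
      assume "\<not> v mod p * l + v div p < q"
      hence "v div p = l - 1" "v mod p * l + l = p * l"
        using d le l by (simp_all add: mult.commute[of p])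
      hence "v mod p + 1 = p"
        using l_pos by (metis mult_right_cancel neq0_conv add_mult_distrib mult_1)
      hence "v + 1 = (l - 1) * p + p"
        using \<open>v div p = l - 1\<close> by (metis add.assoc div_mult_mod_eq)
      hence "v + 1 = l * p"
        using l_pos by (metis Suc_diff_1 add.commute mult_Suc)
      thus False
        using \<open>v + 1 < l * p\<close> by simp
    qed
    thus ?thesis
      by simp
  qed
qed

text \<open>Passing from \<open>M\<close> to \<open>M + 1\<close> adds a box at
  \<open>pos (M + 1)\<close> and removes one at \<open>M p + 1\<close>. By
  \<open>box_telescope\<close> the difference is a sum of pairs of impulses, each moving the entry
  of one column by one row. Truncated subtraction keeps the columns up to \<open>M\<close> in row
  0.\<close>

lemma act_prefix_box:
  assumes "M < l * (p - 1)"
  shows "act (prefix True M) box n =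
    (\<Sum>u<q. delta (p * q) (n - int (u * p) + int ((u - M) div l * q)))"
  using assms
proof (induction M)
  case 0
  thus ?case
    using box_reindex[of n] by (simp add: act_prefix_True pos_def)
next
  case (Suc M)
  define D where "D M' u = (delta (p * q) (n - int (u * p) + int ((u - M') div l * q)) :: complex)" for M' u
  \<comment> \<open>\<open>J\<close> counts the columns \<open>M + l\<close>,
    \<open>M + 2 l\<close>, ... below \<open>q\<close>, the only ones whose entry moves. It is also
    the distance from \<open>M p + 1\<close> to \<open>pos (M + 1)\<close>.\<close>
  define J where "J = (q - 1 - M) div l"
  have lp: "l * (p - 1) + l = q + 1"
    using l p_pos by (metis Suc_diff_1 add.commute mult_Suc_right)
  have J: "J + 1 + (M + 1) div l = p"
  proof -
    have "(q - 1 - M) div l = p - 1 - (M + 1) div l"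
    proof (rule div_nat_eqI)
      define d e where "d = (M + 1) div l" and "e = (M + 1) mod l"
      have M: "M + 1 = d * l + e" "e < l"
        using l_pos by (simp_all add: d_def e_def)
      have "d < p - 1"
        unfolding d_def using Suc.prems l_pos by (simp add: div_less_iff_less_mult mult.commute)
      then obtain t where t: "p - 1 = d + t + 1"
        by (metis Suc_eq_plus1 add.assoc less_imp_Suc_add)
      have tl: "q = d * l + t * l + l + l - 1"
        using lp unfolding t by (simp add: algebra_simps)
      have sub: "p - 1 - (M + 1) div l = t + 1"
        unfolding d_def [symmetric] t by simp
      have "q - 1 - M = t * l + l + l - 1 - e"
        using tl M by simp
      thus "l * (p - 1 - (M + 1) div l) \<le> q - 1 - M" "q - 1 - M < l * Suc (p - 1 - (M + 1) div l)"
        unfolding sub using M(2) by (auto simp: algebra_simps)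
    qed
    moreover have "(M + 1) div l < p - 1"
      using Suc.prems l_pos by (simp add: div_less_iff_less_mult mult.commute)
    ultimately show ?thesis
      unfolding J_def by simp
  qed
  have zero: "D (Suc M) u = D M u" if "u \<notin> (\<lambda>j. M + (j + 1) * l) ` {..<J}" "u < q" for u
  proof -
    have "(u - Suc M) div l = (u - M) div l"
    proof (rule ccontr)
      assume neq: "(u - Suc M) div l \<noteq> (u - M) div l"
      hence "u > M"
        by (cases "u \<le> M") auto
      hence um: "u - M = Suc (u - Suc M)"
        by simp
      hence "l dvd u - M"
        using neq by (metis div_Suc dvd_eq_mod_eq_0)
      then obtain i where i: "u - M = l * i" ..
      hence "i > 0"
        using \<open>u > M\<close> by (cases i) auto
      have "l * i \<le> q - 1 - M"
        using i that(2) by simp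
      hence "i \<le> J"
        using l_pos unfolding J_def by (simp add: less_eq_div_iff_mult_less_eq mult.commute)
      hence "u = M + ((i - 1) + 1) * l" "i - 1 \<in> {..<J}"
        using i \<open>i > 0\<close> \<open>u > M\<close> by (auto simp: mult.commute)
      thus False
        using that(1) by blast
    qed
    thus ?thesis
      by (simp add: D_def)
  qed
  have "(\<Sum>u<q. D (Suc M) u) - (\<Sum>u<q. D M u) = (\<Sum>u<q. D (Suc M) u - D M u)"
    by (simp add: sum_subtractf)
  also have "\<dots> = (\<Sum>u\<in>(\<lambda>j. M + (j + 1) * l) ` {..<J}. D (Suc M) u - D M u)"
  proof (rule sum.mono_neutral_right)
    show "(\<lambda>j. M + (j + 1) * l) ` {..<J} \<subseteq> {..<q}"
    proof safe
      fix j assume "j < J"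
      hence "j + 1 \<le> (q - 1 - M) div l"
        by (simp add: J_def)
      hence "(j + 1) * l \<le> q - 1 - M"
        using l_pos by (simp only: less_eq_div_iff_mult_less_eq)
      moreover have "(j + 1) * l > 0"
        using l_pos by simp
      ultimately show "M + (j + 1) * l < q"
        by linarith
    qed
  qed (use zero in auto)
  also have "\<dots> = (\<Sum>j<J. D (Suc M) (M + (j + 1) * l) - D M (M + (j + 1) * l))"
    using l_pos by (subst sum.reindex) (auto simp: inj_on_def)
  also have "\<dots> = (\<Sum>j<J. box (n - int (M * p + 1) - int (Suc j)) - box (n - int (M * p + 1) - int j))"
  proof (rule sum.cong [OF refl])
    fix j
    have lpq: "int l * int p = int q + 1"
      using l by (metis of_nat_1 of_nat_add of_nat_mult)
    have d1: "(M + (j + 1) * l - M) div l = j + 1"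
      using l_pos by simp
    have d2: "(M + (j + 1) * l - Suc M) div l = j"
    proof -
      define e where "e = l - 1"
      have "M + (j + 1) * l - Suc M = j * l + e" "e < l"
        using l_pos by (simp_all add: e_def)
      thus ?thesis
        by simp
    qed
    have e: "int ((M + (j + 1) * l) * p) = int M * int p + int j * int q + int j + int q + 1"
    proof -
      have "int ((M + (j + 1) * l) * p) = int M * int p + (int j + 1) * (int l * int p)"
        by (simp add: algebra_simps)
      thus ?thesis
        unfolding lpq by (simp add: algebra_simps)
    qed
    have D1: "D (Suc M) (M + (j + 1) * l) = delta (p * q) (n - int (M * p + 1) - int j - int q)"
      unfolding D_def d2 e by (simp add: algebra_simps)
    have D2: "D M (M + (j + 1) * l) = delta (p * q) (n - int (M * p + 1) - int j)"
      unfolding D_def d1 e by (simp add: algebra_simps)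
    show "D (Suc M) (M + (j + 1) * l) - D M (M + (j + 1) * l) =
        box (n - int (M * p + 1) - int (Suc j)) - box (n - int (M * p + 1) - int j)"
      unfolding D1 D2 using box_telescope[of "n - int (M * p + 1) - int j"] by (simp add: algebra_simps)
  qed
  also have "\<dots> = box (n - int (M * p + 1) - int J) - box (n - int (M * p + 1) - int 0)"
    by (rule sum_lessThan_telescope)
  also have "n - int (M * p + 1) - int J = n - int (pos (Suc M))"
  proof -
    have "pos (Suc M) = M * p + 1 + J"
      using pos_eq[of "Suc M"] J by simp
    thus ?thesis
      by simp
  qed
  finally have "(\<Sum>u<q. D (Suc M) u) = (\<Sum>u<q. D M u) + box (n - int (pos (Suc M))) - box (n - int (M * p + 1))"
    by (simp add: algebra_simps)
  also have "(\<Sum>u<q. D M u) = act (prefix True M) box n"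
    using Suc by (simp add: D_def)
  finally show ?case
    by (simp add: D_def act_prefix_True)
qed

lemma delta_crt: "delta (p * q) (x * int p + y * int q) = of_bool (int q dvd x \<and> int p dvd y)"
proof -
  have "int (p * q) dvd x * int p + y * int q \<longleftrightarrow> int q dvd x \<and> int p dvd y"
  proof
    assume *: "int (p * q) dvd x * int p + y * int q"
    moreover have "int q dvd int (p * q)" "int p dvd int (p * q)"
      by simp_all
    ultimately have "int q dvd x * int p + y * int q" "int p dvd x * int p + y * int q"
      by (blast intro: dvd_trans)+
    hence "int q dvd x * int p" "int p dvd y * int q"
      by (simp_all add: dvd_add_left_iff dvd_add_right_iff)
    thus "int q dvd x \<and> int p dvd y"
      using coprime_pq by (simp add: coprime_dvd_mult_left_iff coprime_commute)
  next
    assume "int q dvd x \<and> int p dvd y"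
    thus "int (p * q) dvd x * int p + y * int q"
      by (auto simp: mult_ac intro: dvd_add)
  qed
  thus ?thesis
    by (simp add: delta_def)
qed

text \<open>The exponent \<open>pos m\<close> has column \<open>m mod l\<close> and row
  \<open>m div l\<close>. As \<open>1 = l p - q\<close>, the exponent \<open>m p + 1\<close> is
  \<open>(m + l) p - q\<close>: column \<open>m + l\<close>, row -1.\<close>

lemma act_prefix_delta_eval:
  assumes M: "M < l * (p - 1)" and u: "u < q"
  shows "act (prefix True M) (delta (p * q)) (int u * int p + K * int q) =
    of_bool (u < l \<and> nat (K mod int p) * l + u \<le> M) - of_bool (l \<le> u \<and> u < M + l \<and> int p dvd K + 1)"
proof -
  let ?n = "int u * int p + K * int q"
  define k where "k = nat (K mod int p)"
  have lp: "l * (p - 1) + l = q + 1"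
    using l p_pos by (metis Suc_diff_1 add.commute mult_Suc_right)
  have "l * 1 \<le> l * (p - 1)"
    using p_ge_2 by (intro mult_left_mono) auto
  hence lq: "l \<le> q"
    using lp l_pos by linarith
  have dvd_q: "int q dvd int i - int j \<longleftrightarrow> i = j" if "i < q" "j < q" for i j
  proof
    assume "int q dvd int i - int j"
    thus "i = j"
      using that dvd_imp_le_int[of "int i - int j" "int q"] by fastforce
  qed simp
  have summand1: "delta (p * q) (?n - int (pos m)) = (if m = k * l + u \<and> u < l then 1 else 0 :: complex)"
    if m: "m \<le> M" for m
  proof -
    have "?n - int (pos m) = (int u - int (m mod l)) * int p + (K - int (m div l)) * int q"
      by (simp add: pos_def algebra_simps)
    hence *: "delta (p * q) (?n - int (pos m)) =
        (of_bool (int q dvd int u - int (m mod l) \<and> int p dvd K - int (m div l)) :: complex)"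
      by (simp only: delta_crt)
    have "m mod l < q"
      using l_pos lq by (meson mod_less_divisor order_less_le_trans)
    hence 1: "int q dvd int u - int (m mod l) \<longleftrightarrow> u = m mod l"
      using u by (intro dvd_q)
    have "m div l < p - 1"
      using m M l_pos by (simp add: div_less_iff_less_mult mult.commute)
    hence "int (m div l) mod int p = int (m div l)"
      by simp
    hence "int p dvd K - int (m div l) \<longleftrightarrow> K mod int p = int (m div l)"
      by (simp only: mod_eq_dvd_iff [symmetric])
    also have "K mod int p = int k"
      using p_pos by (simp add: k_def)
    also have "int k = int (m div l) \<longleftrightarrow> k = m div l"
      by (rule of_nat_eq_iff)
    finally have 2: "int p dvd K - int (m div l) \<longleftrightarrow> k = m div l" .
    have "u = m mod l \<and> k = m div l \<longleftrightarrow> m = k * l + u \<and> u < l"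
      using l_pos by auto
    with * 1 2 show ?thesis
      by simp
  qed
  have "(\<Sum>m\<le>M. delta (p * q) (?n - int (pos m))) =
      (\<Sum>m\<le>M. if m = k * l + u \<and> u < l then 1 else 0 :: complex)"
    by (rule sum.cong [OF refl]) (simp only: atMost_iff summand1)
  hence s1: "(\<Sum>m\<le>M. delta (p * q) (?n - int (pos m))) = (of_bool (u < l \<and> k * l + u \<le> M) :: complex)"
    by (cases "u < l") simp_all
  have summand2: "delta (p * q) (?n - int (m * p + 1)) = (if m = u - l \<and> l \<le> u \<and> int p dvd K + 1 then 1 else 0 :: complex)"
    if m: "m < M" for m
  proof -
    have "int l * int p = int q + 1"
      using l by (metis of_nat_1 of_nat_add of_nat_mult)
    hence "?n - int (m * p + 1) = (int u - int (m + l)) * int p + (K + 1) * int q"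
      by (simp add: algebra_simps)
    hence "delta (p * q) (?n - int (m * p + 1)) =
        (of_bool (int q dvd int u - int (m + l) \<and> int p dvd K + 1) :: complex)"
      by (simp only: delta_crt)
    moreover have "int q dvd int u - int (m + l) \<longleftrightarrow> u = m + l"
      using u m M lp by (intro dvd_q) linarith+
    ultimately show ?thesis
      by auto
  qed
  have "(\<Sum>m<M. delta (p * q) (?n - int (m * p + 1))) =
      (\<Sum>m<M. if m = u - l \<and> l \<le> u \<and> int p dvd K + 1 then 1 else 0 :: complex)"
    by (rule sum.cong [OF refl]) (simp only: lessThan_iff summand2)
  hence s2: "(\<Sum>m<M. delta (p * q) (?n - int (m * p + 1))) =
      (of_bool (l \<le> u \<and> u < M + l \<and> int p dvd K + 1) :: complex)"
    by (cases "l \<le> u \<and> int p dvd K + 1") auto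
  have "act (prefix True M) (delta (p * q)) ?n =
      (\<Sum>m\<le>M. delta (p * q) (?n - int (pos m))) - (\<Sum>m<M. delta (p * q) (?n - int (m * p + 1)))"
    unfolding act_prefix_True lessThan_Suc_atMost [symmetric] sum.lessThan_Suc sum_subtractf by simp
  thus ?thesis
    unfolding s1 s2 by (simp add: k_def)
qed

text \<open>
  By the Chinese remainder theorem an index is \<open>U p + K q\<close> with \<open>U\<close> modulo \<open>q\<close> and \<open>K\<close> modulo \<open>p\<close>.
  In column \<open>U\<close>, the product of \<open>prefix True M\<close> with \<open>1 + x + \<dots> + x\<^sup>q\<^sup>-\<^sup>1\<close> has exactly one
  nonzero entry, namely a one in row \<open>- column_shift M U\<close>.
\<close>

definition column_shift :: "nat \<Rightarrow> int \<Rightarrow> int" where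
  "column_shift M U = max 0 ((U mod int q - int M) div int l)"

lemma act_prefix_box_eval:
  assumes M: "M < l * (p - 1)"
  shows "act (prefix True M) box (U * int p + K * int q) = of_bool (int p dvd K + column_shift M U)"
proof -
  define v where "v = nat (U mod int q)"
  have v: "int v = U mod int q" "v < q"
    using q_pos by (simp_all add: v_def nat_less_iff)
  have summand: "delta (p * q) (U * int p + K * int q - int (u * p) + int ((u - M) div l * q)) =
      (if u = v then of_bool (int p dvd K + int ((v - M) div l)) else 0 :: complex)" if "u < q" for u
  proof -
    have "U * int p + K * int q - int (u * p) + int ((u - M) div l * q) =
        (U - int u) * int p + (K + int ((u - M) div l)) * int q"
      by (simp add: algebra_simps)
    hence "delta (p * q) (U * int p + K * int q - int (u * p) + int ((u - M) div l * q)) =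
        (of_bool (int q dvd U - int u \<and> int p dvd K + int ((u - M) div l)) :: complex)"
      by (simp only: delta_crt)
    moreover have "int q dvd U - int u \<longleftrightarrow> u = v"
      unfolding mod_eq_dvd_iff [symmetric] v(1) [symmetric] using that by auto
    ultimately show ?thesis
      by simp
  qed
  have "act (prefix True M) box (U * int p + K * int q) =
      (\<Sum>u<q. if u = v then of_bool (int p dvd K + int ((v - M) div l)) else 0)"
    unfolding act_prefix_box[OF M] by (rule sum.cong [OF refl]) (simp only: lessThan_iff summand)
  hence "act (prefix True M) box (U * int p + K * int q) = of_bool (int p dvd K + int ((v - M) div l))"
    using v(2) by simp
  moreover have "int ((v - M) div l) = column_shift M U"
  proof (cases "M \<le> v")
    case True
    thus ?thesis
      by (simp add: column_shift_def zdiv_int of_nat_diff v(1) [symmetric] max_absorb2 pos_imp_zdiv_nonneg_iff l_pos)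
  next
    case False
    hence "(int v - int M) div int l < 0"
      using l_pos by (intro div_neg_pos_less0) auto
    thus ?thesis
      using False by (simp add: column_shift_def v(1) [symmetric])
  qed
  ultimately show ?thesis
    by simp
qed

end

section \<open>The bound for F by comparison of supports\<close>

lemma int_dvd_small: "a dvd x \<Longrightarrow> \<bar>x\<bar> < a \<Longrightarrow> x = (0 :: int)"
  using dvd_imp_le_int[of x a] by linarith

lemma div_eqI: "a = t * b + s \<Longrightarrow> 0 \<le> s \<Longrightarrow> s < b \<Longrightarrow> a div b = (t :: int)"
  by (rule int_div_pos_eq[of _ b _ s]) (simp_all add: mult.commute)

context binary_cyclotomic_flat
begin

text \<open>\<open>P\<close> is the truncation in column \<open>u\<close>; the other two indicators
  come from its product with the box. For \<open>u\<close> at least \<open>l\<close>, either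
  \<open>P\<close> vanishes or the third indicator cancels the second value of \<open>P\<close>. For
  \<open>u < l\<close> and \<open>u\<close> at most \<open>M\<close>, \<open>P\<close> indicates the
  rows up to a bound \<open>D\<close>, and exactly the values 2 and -2 have to be excluded.\<close>

lemma F_bound_aux:
  fixes u M J I :: nat and k \<omega> :: int
  assumes M: "M < l * (p - 1)" and J: "J + 2 \<le> p" and I: "I < l" and \<omega>: "\<omega> = 0 \<or> \<omega> = 1"
    and u: "u < q" and k: "0 \<le> k" "k < int p"
  defines "P \<equiv> \<lambda>K. of_bool (u < l \<and> nat (K mod int p) * l + u \<le> M) -
      of_bool (l \<le> u \<and> u < M + l \<and> int p dvd K + 1) :: int"
  defines "e3 \<equiv> column_shift M (int u - int I - \<omega>)"
    and "e4 \<equiv> column_shift M (int u - int I - (int J + 1) * int l)"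
  shows "\<bar>P k - P (k - (int J + 1)) - of_bool (int p dvd k - int J + e3) + of_bool (int p dvd k + 1 + e4)\<bar> \<le> 1"
proof (cases "u < l")
  case False
  have "e3 = 0" if "u < M + l"
  proof -
    have "(int u - int I - \<omega>) mod int q = int u - int I - \<omega>"
      using False u I \<omega> by (intro mod_pos_pos_trivial) auto
    moreover have "\<not> 0 < (int u - int I - \<omega> - int M) div int l"
      using that \<omega> l_pos by (auto simp: pos_imp_zdiv_pos_iff)
    ultimately show ?thesis
      by (simp add: e3_def column_shift_def)
  qed
  thus ?thesis
    using False by (cases "u < M + l") (auto simp: P_def of_bool_def)
next
  case True
  note ul = this
  show ?thesis
  proof (cases "u \<le> M")
    case False
    hence "P K = 0" for K
      using ul by (simp add: P_def)
    thus ?thesis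
      by simp
  next
    case uM: True
    have lq: "int q = int l * int p - 1"
      using l by (metis add_diff_cancel_right' of_nat_1 of_nat_add of_nat_mult)
    define D \<rho> where "D = (M - u) div l" and "\<rho> = (M - u) mod l"
    have MD: "M = u + (D * l + \<rho>)" "\<rho> < l"
      using uM l_pos by (auto simp: D_def \<rho>_def)
    have D: "int M = int u + int D * int l + int \<rho>" "\<rho> < l"
      using arg_cong[OF MD(1), of int] MD(2) by (simp_all only: of_nat_add of_nat_mult add.assoc)
    have "D < p - 1"
      unfolding D_def using M l_pos by (simp add: div_less_iff_less_mult mult.commute)
    hence Dp: "int D + 2 \<le> int p"
      by linarith
    have P: "P K = of_bool (K mod int p \<le> int D)" for K
    proof -
      define i where "i = nat (K mod int p)"
      have i: "int i = K mod int p"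
        using p_pos by (simp add: i_def)
      have "i * l + u \<le> M \<longleftrightarrow> i * l \<le> M - u"
        using uM by linarith
      also have "\<dots> \<longleftrightarrow> i \<le> D"
        unfolding D_def by (rule less_eq_div_iff_mult_less_eq [symmetric]) (rule l_pos)
      finally show ?thesis
        using ul by (simp add: P_def i_def [symmetric] i [symmetric])
    qed
    \<comment> \<open>\<open>R\<close>, and \<open>R'\<close> below, increase \<open>D\<close> by
      the carry in adding \<open>I\<close> to the remainder \<open>\<rho>\<close>; in
      \<open>R'\<close> the shift \<open>\<omega>\<close> takes part, so that
      \<open>R \<le> R'\<close>.\<close>
    define R where "R = int D + of_bool (\<rho> + I \<ge> l)"
    have e4: "e4 = max 0 (int p - 2 - int J - R)"
    proof -
      let ?U = "int u - int I - (int J + 1) * int l"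
      have "(int J + 1) * int l \<le> (int p - 1) * int l"
        using J by (intro mult_right_mono) auto
      hence lower: "?U \<ge> - int q"
        using I unfolding lq by (simp add: algebra_simps)
      have "1 * int l \<le> (int J + 1) * int l"
        by (intro mult_right_mono) auto
      hence upper: "?U < 0"
        using ul by linarith
      show ?thesis
      proof (cases "?U = - int q")
        case True
        have "(int J + 2) * int l > (int p - 1) * int l"
        proof -
          have "int q = int I + (int J + 1) * int l - int u"
            using True by linarith
          hence "int l * int p - 1 < int l + (int J + 1) * int l"
            using I unfolding lq by linarith
          hence "(int p - 1) * int l < (int J + 1) * int l + 1"
            by (simp add: algebra_simps)
          thus ?thesis
            using l_pos by (simp add: algebra_simps)
        qed
        hence "int p - 2 - int J \<le> 0"
          using l_pos by (simp add: mult_less_cancel_right)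
        moreover have "R \<ge> 0"
          by (simp add: R_def)
        moreover have "?U mod int q = 0"
          unfolding True by simp
        moreover have "\<not> 0 < (0 - int M) div int l"
          using l_pos by (subst pos_imp_zdiv_pos_iff) auto
        ultimately show ?thesis
          by (simp add: e4_def column_shift_def)
      next
        case False
        have "?U mod int q = (?U + int q) mod int q"
          by simp
        also have "\<dots> = ?U + int q"
          using lower upper False by (intro mod_pos_pos_trivial) auto
        finally have "?U mod int q - int M = (int p - 1 - int J - int D) * int l - int \<rho> - int I - 1"
          unfolding D lq by (simp add: algebra_simps)
        hence "(?U mod int q - int M) div int l = int p - 2 - int J - R"
          using D(2) I
          by (intro div_eqI[where s = "int l - 1 - int \<rho> - int I + of_bool (\<rho> + I \<ge> l) * int l"])
             (auto simp: R_def algebra_simps of_bool_def)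
        thus ?thesis
          by (simp add: e4_def column_shift_def)
      qed
    qed
    define R' where "R' = int D + of_bool (int \<rho> + int I + \<omega> \<ge> int l)"
    have e3: "e3 = (if int u - int I - \<omega> \<ge> 0 then 0 else int p - 1 - R')"
    proof -
      let ?U = "int u - int I - \<omega>"
      show ?thesis
      proof (cases "?U \<ge> 0")
        case True
        have "?U mod int q = ?U"
          using True u \<omega> by (intro mod_pos_pos_trivial) auto
        moreover have "\<not> 0 < (?U - int M) div int l"
          using uM \<omega> I l_pos by (auto simp: pos_imp_zdiv_pos_iff)
        ultimately show ?thesis
          using True by (simp add: e3_def column_shift_def)
      next
        case False
        have "int l * 2 \<le> int l * int p"
          using p_ge_2 by (intro mult_left_mono) auto
        hence "int l \<le> int q"
          using l_pos unfolding lq by linarith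
        moreover have "?U \<ge> - int l"
          using I \<omega> by auto
        ultimately have bound: "?U \<ge> - int q" "?U < 0"
          using False by linarith+
        have "(?U mod int q - int M) div int l = int p - 1 - R'"
        proof -
          have "?U mod int q = (?U + int q) mod int q"
            by simp
          also have "\<dots> = ?U + int q"
            using bound by (intro mod_pos_pos_trivial) auto
          finally have "?U mod int q - int M = (int p - int D) * int l - (1 + int I + \<omega> + int \<rho>)"
            unfolding D lq by (simp add: algebra_simps)
          thus ?thesis
            using D(2) I \<omega>
            by (intro div_eqI[where s = "int l - (1 + int I + \<omega> + int \<rho>) +
                  of_bool (int \<rho> + int I + \<omega> \<ge> int l) * int l"])
               (auto simp: R'_def algebra_simps of_bool_def)
        qed
        moreover have "int p - 1 - R' \<ge> 0"
          using Dp by (simp add: R'_def)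
        ultimately show ?thesis
          using False by (simp add: e3_def column_shift_def)
      qed
    qed
    have RD: "R = int D \<or> R = int D + 1" "R' = int D \<or> R' = int D + 1" "R \<le> R'"
      using \<omega> by (auto simp: R_def R'_def)
    have kmod: "k mod int p = k"
      using k by simp
    show ?thesis
    proof (cases "k \<le> int D")
      case True
      \<comment> \<open>Here \<open>P k = 1\<close>. The last indicator must vanish, which excludes
        the value 2: the relevant number is either \<open>k + 1\<close> or lies strictly between
        \<open>- p\<close> and 0.\<close>
      have "\<not> int p dvd k + 1 + e4"
      proof
        assume dvd: "int p dvd k + 1 + e4"
        show False
        proof (cases "int p - 2 - int J - R \<le> 0")
          case True
          thus False
            using dvd \<open>k \<le> int D\<close> k Dp int_dvd_small[of "int p" "k + 1"] by (simp add: e4)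
        next
          case False
          hence "k + 1 + e4 - int p = k - 1 - int J - R"
            by (simp add: e4)
          hence "int p dvd k - 1 - int J - R"
            using dvd by (metis dvd_diff dvd_refl)
          moreover have "k - 1 - int J - R < 0" "k - 1 - int J - R > - int p"
            using \<open>k \<le> int D\<close> RD False k by linarith+
          ultimately show False
            using int_dvd_small[of "int p" "k - 1 - int J - R"] by linarith
        qed
      qed
      thus ?thesis
        unfolding P kmod using True by (simp add: of_bool_def)
    next
      case False
      \<comment> \<open>Here \<open>P k = 0\<close>. If both negative indicators are 1, then
        \<open>k = J + 1 + D\<close> and \<open>R = D\<close>, which forces the last indicator to be
        1 and excludes the value -2.\<close>
      have "int p dvd k + 1 + e4"
        if *: "(k - (int J + 1)) mod int p \<le> int D" "int p dvd k - int J + e3"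
      proof -
        have J1: "int J + 2 \<le> int p"
          using J by linarith
        have ge: "k - (int J + 1) \<ge> 0"
        proof (rule ccontr)
          assume neg: "\<not> k - (int J + 1) \<ge> 0"
          have "(k - (int J + 1)) mod int p = (k - (int J + 1) + int p) mod int p"
            by simp
          also have "\<dots> = k - (int J + 1) + int p"
            using neg k J1 by (intro mod_pos_pos_trivial) linarith+
          finally show False
            using *(1) False J1 by linarith
        qed
        hence "(k - (int J + 1)) mod int p = k - (int J + 1)"
          using k by (intro mod_pos_pos_trivial) linarith+
        hence le: "k - (int J + 1) \<le> int D"
          using *(1) by linarith
        have neg: "\<not> int u - int I - \<omega> \<ge> 0"
        proof
          assume "int u - int I - \<omega> \<ge> 0"
          hence "int p dvd k - int J"
            using *(2) e3 by simp
          thus False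
            using int_dvd_small[of "int p" "k - int J"] ge le Dp by linarith
        qed
        hence "k - int J + e3 - int p = k - (int J + 1) - R'"
          using e3 by simp
        hence "int p dvd k - (int J + 1) - R'"
          using *(2) by (metis dvd_diff dvd_refl)
        hence "k - (int J + 1) - R' = 0"
          by (rule int_dvd_small) (use ge le RD Dp in linarith)
        hence "R = int D" "k = int J + 1 + int D"
          using RD le by linarith+
        hence "k + 1 + e4 = int p"
          using k e4 by simp
        thus ?thesis
          by simp
      qed
      thus ?thesis
        unfolding P kmod using False by (auto simp: of_bool_def)
    qed
  qed
qed

text \<open>The second truncation enters only through its closed product with \<open>C\<close>; its
  factor \<open>1 + x + ... + x^(q-1)\<close> is moved onto the impulse, so that just the two
  evaluations of the first truncation are required.\<close>

lemma F_prefix_eval: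
  assumes a: "\<And>u n. partial a u n = act (prefix True M) u n"
    and a': "\<And>u n. partial a' u n = act (prefix w M') u n"
  shows "F a a' n = act (prefix True M) (delta (p * q)) n
    - act (prefix True M) (delta (p * q)) (n - int ((M' div l + 1) * q))
    - act (prefix True M) box (n - int (pos M') - of_bool w * int p)
    + act (prefix True M) box (n - int (pos M') - int (M' div l + 1))"
proof -
  let ?d = "delta (p * q)"
  have "F a a' n = act (prefix w M' * C) (act (prefix True M) ?d) n"
    unfolding F_def a a' c_def
    by (simp only: act_mult [symmetric] mult.commute mult.left_commute)
  also have "\<dots> = act (prefix True M) ?d n - act (prefix True M) ?d (n - int ((M' div l + 1) * q)) -
      act (monom 1 (pos M')) (act ((if w then monom 1 p else 1) - monom 1 (M' div l + 1))
        (act (\<Sum>i<q. monom 1 i) (act (prefix True M) ?d))) n"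
  proof -
    have reorder: "act (A * G * H) u n = act A (act H (act G u)) n" for A G H :: "complex poly" and u
      by (simp only: act_mult [symmetric] mult_ac)
    show ?thesis
      unfolding prefix_times_C act_diff[of "1 - _"] act_diff[of 1] reorder act_1
      by (simp only: act_monom[of 1 "(M' div l + 1) * q"] mult_1)
  qed
  also have "act (\<Sum>i<q. monom 1 i) (act (prefix True M) ?d) = act (prefix True M) box"
    by (rule ext) (simp only: box_def act_commute)
  finally show ?thesis
    by (cases w) (simp_all add: act_diff act_monom algebra_simps del: of_nat_add of_nat_mult)
qed

lemma crt_representation:
  obtains u k where "u < q" "0 \<le> k" "k < int p" "[n = int u * int p + k * int q] (mod int (p * q))"
proof -
  have lq: "int l * int p = int q + 1"
    using l by (metis of_nat_1 of_nat_add of_nat_mult)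
  \<comment> \<open>\<open>l\<close> is the inverse of \<open>p\<close> modulo
    \<open>q\<close>.\<close>
  define u where "u = nat ((n * int l) mod int q)"
  have u: "int u = (n * int l) mod int q" "u < q"
    using q_pos by (simp_all add: u_def nat_less_iff)
  have "[int u * int p = n * int l * int p] (mod int q)"
    unfolding u(1) by (intro cong_mult cong_refl) (simp add: cong_def)
  also have "n * int l * int p = n + n * int q"
    by (simp add: mult.assoc lq algebra_simps)
  also have "[n + n * int q = n] (mod int q)"
    by (simp add: cong_def)
  finally have "int q dvd n - int u * int p"
    by (simp add: cong_iff_dvd_diff dvd_diff_commute)
  then obtain k0 where k0: "n - int u * int p = int q * k0" ..
  have "n - (int u * int p + (k0 mod int p) * int q) = int q * (k0 - k0 mod int p)"
    using k0 by (simp add: algebra_simps)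
  also have "\<dots> = int (p * q) * (k0 div int p)"
    by (simp add: minus_mod_eq_mult_div)
  finally have "[n = int u * int p + (k0 mod int p) * int q] (mod int (p * q))"
    by (simp add: cong_iff_dvd_diff)
  thus ?thesis
    using that[of u "k0 mod int p"] u p_pos by simp
qed

lemma cmod_F_le_1_aux:
  assumes M: "M < l * (p - 1)" and a: "\<And>u n. partial a u n = act (prefix True M) u n"
    and M': "M' < l * (p - 1)" and a': "\<And>u n. partial a' u n = act (prefix w M') u n"
  shows "cmod (F a a' n) \<le> 1"
proof -
  obtain u k where u: "u < q" and k: "0 \<le> k" "k < int p"
    and n: "[n = int u * int p + k * int q] (mod int (p * q))"
    by (rule crt_representation)
  define J I where "J = M' div l" and "I = M' mod l"
  define \<omega> :: int where "\<omega> = of_bool w"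
  have lq: "int l * int p = int q + 1"
    using l by (metis of_nat_1 of_nat_add of_nat_mult)
  let ?n = "int u * int p + k * int q"
  have "J < p - 1"
    unfolding J_def using M' l_pos by (simp add: div_less_iff_less_mult mult.commute)
  hence J: "J + 2 \<le> p"
    by linarith
  have pos: "int (pos M') = int J * int q + int I * int p"
    by (simp add: pos_def J_def I_def)
  have n2: "?n - int ((M' div l + 1) * q) = int u * int p + (k - (int J + 1)) * int q"
    by (simp add: J_def [symmetric] algebra_simps)
  have n3: "?n - int (pos M') - of_bool w * int p = (int u - int I - \<omega>) * int p + (k - int J) * int q"
    unfolding pos \<omega>_def by (simp add: algebra_simps)
  \<comment> \<open>The shift by \<open>J + 1\<close> is rewritten through
    \<open>1 = l p - q\<close>; its row part cancels the row \<open>J\<close> of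
    \<open>pos M'\<close> and leaves \<open>k + 1\<close>.\<close>
  have n4: "?n - int (pos M') - int (M' div l + 1) =
      (int u - int I - (int J + 1) * int l) * int p + (k + 1) * int q"
  proof -
    have "(int J + 1) * int l * int p = (int J + 1) * (int q + 1)"
      by (simp only: mult.assoc lq)
    thus ?thesis
      unfolding pos J_def [symmetric] by (simp add: algebra_simps)
  qed
  let ?P = "\<lambda>K. of_bool (u < l \<and> nat (K mod int p) * l + u \<le> M) -
      of_bool (l \<le> u \<and> u < M + l \<and> int p dvd K + 1) :: int"
  let ?X = "?P k - ?P (k - (int J + 1)) -
      of_bool (int p dvd k - int J + column_shift M (int u - int I - \<omega>)) +
      of_bool (int p dvd k + 1 + column_shift M (int u - int I - (int J + 1) * int l))"
  have "F a a' n = F a a' ?n"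
    by (rule F_cong) (rule n)
  also have "\<dots> = of_int ?X"
    unfolding F_prefix_eval[OF a a'] n2 n3 n4 act_prefix_delta_eval[OF M u] act_prefix_box_eval[OF M]
    by simp
  finally have "cmod (F a a' n) = of_int \<bar>?X\<bar>"
    by (simp only: norm_of_int)
  also have "\<bar>?X\<bar> \<le> 1"
    using M J _ _ u k by (rule F_bound_aux) (use l_pos in \<open>auto simp: I_def \<omega>_def\<close>)
  finally show ?thesis
    by simp
qed

lemma act_prefix_const: "act (prefix w M) (\<lambda>_. 1) n = of_bool w"
  by (simp add: prefix_def act_add act_sum act_diff act_monom)

lemma cmod_F_le_1: "cmod (F a a' n) \<le> 1"
proof (cases "a \<le> degree B \<and> a' \<le> degree B")
  case False
  thus ?thesis
    using F_eq_0[of a a' n] by (auto simp: not_le)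
next
  case True
  obtain w M where M: "M < l * (p - 1)" "\<And>u n. partial a u n = act (prefix w M) u n"
    by (rule partial_eq_prefix[of a]) blast
  obtain w' M' where M': "M' < l * (p - 1)" "\<And>u n. partial a' u n = act (prefix w' M') u n"
    by (rule partial_eq_prefix[of a']) blast
  define b b' where "b = degree B + 1 - a" and "b' = degree B + 1 - a'"
  obtain v N where N: "N < l * (p - 1)" "\<And>u n. partial b u n = act (prefix v N) u n"
    by (rule partial_eq_prefix[of b]) blast
  obtain v' N' where N': "N' < l * (p - 1)" "\<And>u n. partial b' u n = act (prefix v' N') u n"
    by (rule partial_eq_prefix[of b']) blast
  consider w | w' | "\<not> w" by blast
  thus ?thesis
  proof cases
    case 1
    thus ?thesis
      using cmod_F_le_1_aux[OF M(1) _ M'] M(2) by simp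
  next
    case 2
    thus ?thesis
      using cmod_F_le_1_aux[OF M'(1) _ M] M'(2) F_commute[of a a'] by simp
  next
    case 3
    \<comment> \<open>Evaluation at 1, expressed on the constant sequence: \<open>B\<close> has
      value 1, hence the complement ends in a positive term because the truncation itself does
      not.\<close>
    have "partial b (\<lambda>_. 1) 0 = act B (\<lambda>_. 1) (0 + int (degree B)) - partial a (\<lambda>_. 1) (0 + int (degree B))"
      using partial_complement[of a "\<lambda>_. 1" 0] True unfolding b_def partial_def[of "degree B + 1 - a"] by simp
    hence "of_bool v = (1 :: complex) - of_bool w"
      unfolding M(2) N(2) by (subst (asm) B_eq_prefix) (simp add: act_prefix_const)
    hence v
      using 3 by (cases v) auto
    have "F a a' n = - F b b' (int (2 * degree B + p + q) - 1 - n)"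
      using F_reflect[of a a' "int (2 * degree B + p + q) - 1 - n"] True by (simp add: b_def b'_def)
    moreover have "cmod (F b b' (int (2 * degree B + p + q) - 1 - n)) \<le> 1"
      using cmod_F_le_1_aux[OF N(1) _ N'] N(2) \<open>v\<close> by simp
    ultimately show ?thesis
      by simp
  qed
qed

end

subsection \<open>The main theorem\<close>

lemma cyclotomic_poly_prime:
  assumes "prime p"
  shows "cyclotomic_poly p = (\<Sum>i<p. monom 1 i)"
proof -
  have "cyclotomic_poly (1 * p) * cyclotomic_poly 1 = pcompose (cyclotomic_poly 1) (monom 1 p)"
    using assms by (intro cyclotomic_poly_mult_prime) (auto simp: prime_nat_iff)
  moreover have "[:-1, 1:] = - (1 - monom 1 1 :: complex poly)"
    by (simp add: monom_Suc one_pCons)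
  ultimately have "(1 - monom 1 1) * cyclotomic_poly p = 1 - monom 1 p"
    by (simp add: cyclotomic_poly_1 pcompose_uminus pcompose_diff pcompose_1
        pcompose_monom_monom algebra_simps del: One_nat_def)
  also have "\<dots> = (1 - monom 1 1) * (\<Sum>i<p. monom 1 i)"
    by (rule geometric_poly [symmetric])
  finally show ?thesis
    using one_minus_monom_nonzero[of 1, where ?'a = complex] by (metis mult_left_cancel zero_less_one)
qed

lemma binary_cyclotomic_primes:
  assumes "prime p" "prime q" "p < q"
  shows "binary_cyclotomic p q (cyclotomic_poly (p * q))"
proof
  show "p \<ge> 2"
    using assms by (simp add: prime_ge_2_nat)
  show "p < q"
    by fact
  show "coprime p q"
    using assms by (simp add: primes_coprime)
  have "cyclotomic_poly (p * q) * cyclotomic_poly p = pcompose (cyclotomic_poly p) (monom 1 q)"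
    using assms by (intro cyclotomic_poly_mult_prime) (auto dest: primes_dvd_imp_eq simp: prime_gt_0_nat)
  hence "cyclotomic_poly (p * q) * ((\<Sum>i<p. monom 1 i) * (1 - monom 1 q)) =
      pcompose (\<Sum>i<p. monom 1 i) (monom 1 q) * pcompose (1 - monom 1 1) (monom 1 q)"
    using assms by (simp add: cyclotomic_poly_prime pcompose_diff pcompose_1 pcompose_monom_monom
        mult.assoc [symmetric] del: One_nat_def)
  also have "\<dots> = pcompose ((1 - monom 1 1) * (\<Sum>i<p. monom 1 i)) (monom 1 q)"
    by (simp only: pcompose_mult mult.commute)
  also have "\<dots> = 1 - monom 1 (p * q)"
    by (simp only: geometric_poly pcompose_diff pcompose_1 pcompose_monom_monom)
  finally show "cyclotomic_poly (p * q) * ((\<Sum>i<p. monom 1 i) * (1 - monom 1 q)) = 1 - monom 1 (p * q)" .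
qed

text \<open>For residue -1 the divisor \<open>m\<close> of \<open>r + 1\<close> could only exceed
  \<open>r\<close> by being \<open>r + 1\<close>; this is even, while \<open>m\<close> is odd. The
  bound yields the size conditions on \<open>r\<close> and \<open>s\<close>.\<close>

lemma cong_unit_ge:
  assumes "[int r = 1] (mod int m) \<or> [int r = - 1] (mod int m)" "odd r" "odd m" "r > 1"
  shows "r \<ge> m"
  using assms(1)
proof
  assume "[int r = 1] (mod int m)"
  hence "int m dvd int (r - 1)"
    using assms(4) by (simp add: cong_iff_dvd_diff of_nat_diff)
  hence "m dvd r - 1"
    by (simp only: of_nat_dvd_iff)
  thus ?thesis
    using assms(4) by (auto dest!: dvd_imp_le)
next
  assume "[int r = - 1] (mod int m)"
  hence "int m dvd int (r + 1)"
    by (simp add: cong_iff_dvd_diff add.commute)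
  hence "m dvd r + 1"
    by (simp only: of_nat_dvd_iff)
  hence "m \<le> r + 1"
    by (rule dvd_imp_le) simp
  moreover have "m \<noteq> r + 1"
    using assms(2,3) by auto
  ultimately show ?thesis
    by simp
qed

theorem theorem9p1:
  fixes p q r s :: nat
  assumes "prime p" and "prime q" and "prime r" and "prime s"
    and "odd p" and "odd q" and "odd r" and "odd s"
    and "p < q" and "q < r" and "r < s"
    and "[int r = 1] (mod int (p * q)) \<or> [int r = - 1] (mod int (p * q))"
    and "[int s = 1] (mod int (p * q * r)) \<or> [int s = - 1] (mod int (p * q * r))"
  shows "height (p * q * r * s) = 1 \<longleftrightarrow> [int q = - 1] (mod int p)"
proof -
  let ?B = "cyclotomic_poly (p * q)"
  let ?f = "cyclotomic_poly (p * q * r)"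
  let ?g = "cyclotomic_poly (p * q * r * s)"
  have gt: "p > 1" "q > 1" "r > 1" "s > 1"
    by (intro prime_gt_1_nat assms)+
  interpret binary_cyclotomic p q ?B
    using assms by (intro binary_cyclotomic_primes)
  interpret quaternary_cyclotomic p q ?B r s ?f ?g
  proof
    show "p * q \<le> r"
      using assms gt by (intro cong_unit_ge) auto
    show "p * q * r \<le> s"
      using assms gt by (intro cong_unit_ge) auto
    have "\<not> r dvd p * q"
      using assms by (auto simp: prime_dvd_mult_iff dest: primes_dvd_imp_eq)
    thus "?f * ?B = pcompose ?B (monom 1 r)"
      using assms gt by (intro cyclotomic_poly_mult_prime) auto
    have "\<not> s dvd p * q * r"
      using assms by (auto simp: prime_dvd_mult_iff dest: primes_dvd_imp_eq)
    thus "?g * ?f = pcompose ?f (monom 1 s)"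
      using assms gt by (intro cyclotomic_poly_mult_prime) auto
  qed (use assms in auto)
  have dvd: "[int q = - 1] (mod int p) \<longleftrightarrow> p dvd q + 1"
  proof -
    have "[int q = - 1] (mod int p) \<longleftrightarrow> int p dvd int (q + 1)"
      by (simp add: cong_iff_dvd_diff add.commute)
    thus ?thesis
      by (simp only: of_nat_dvd_iff)
  qed
  show ?thesis
    unfolding height_eq_1_iff dvd
  proof
    assume flat: "\<forall>i. cmod (coeff ?g i) \<le> 1"
    show "p dvd q + 1"
    proof (rule ccontr)
      assume ndvd: "\<not> p dvd q + 1"
      \<comment> \<open>Both follow from parity.\<close>
      have "p \<noteq> 2" "q \<noteq> p + 1"
        using assms by auto
      hence "p \<ge> 3" "p + 2 \<le> q"
        using gt assms by linarith+
      then obtain a L n where "1 \<le> a" "a \<le> degree ?B" "cmod (F a L n) > 1"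
        "\<not> int (p * q) dvd n - int a" "\<not> int (p * q) dvd n - int a + 1"
        using exists_large_F[OF _ _ ndvd] by blast
      then obtain i where "cmod (coeff ?g i) > 1"
        using not_flat_if_F by blast
      thus False
        using flat by (meson not_le)
    qed
  next
    assume "p dvd q + 1"
    then obtain l where "q + 1 = p * l" ..
    then interpret binary_cyclotomic_flat p q ?B l
      by unfold_locales (simp add: mult.commute)
    show "\<forall>i. cmod (coeff ?g i) \<le> 1"
      using flat_if_F[OF cmod_F_le_1] by blast
  qed
qed

end
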